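(* Let $\alpha = 1.293\ldots$ be the unique real solution $\alpha>1$ of the equation $\alpha^{\alpha}\cdot(\alpha-1)^{1-\alpha}=2$. Then $f_s(n)\ge(\alpha-o(1))\,n$ as $n\to\infty$, where $f_s(n)$ denotes the minimum size of a point set in the Euclidean plane that is $n$-universal for the family of stacked triangulations on $n$ vertices.
   Context: All graphs are finite and simple. A plane straight-line embedding of a graph $G$ is an injective map from the vertices of $G$ to points of $\mathbb{R}^2$ such that, drawing each edge as the straight-line segment between the images of its endpoints, no two edges cross: two distinct edges' segments meet at most in the image of a common endpoint, and no segment contains the image of a vertex other than its own endpoints. A finite point set $S\subset\mathbb{R}^2$ is called $n$-universal for a family $\mathcal{G}$ of planar $n$-vertex graphs if every graph $G\in\mathcal{G}$ admits a plane straight-line embedding whose vertices are mapped to points of $S$ (the outer face and the combinatorial embedding are not prescribed; $S$ may have more than $n$ points). A stacked triangulation (also called a planar 3-tree) is any graph obtained from a triangle by repeatedly inserting a new vertex inside a face (possibly the outer face) of the current triangulation and making it adjacent to all three vertices of that face. *)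

theory Defs
  imports "HOL-Analysis.Analysis" "HOL-Library.Multiset" "HOL-Library.Landau_Symbols"
begin

text \<open>
  A finite simple graph is given by its vertex set and its set of edges, every edge being a
  two-element set of vertices.
\<close>

definition plane_straight_line_embedding ::
  "'v set \<Rightarrow> 'v set set \<Rightarrow> ('v \<Rightarrow> real ^ 2) \<Rightarrow> bool" where
  "plane_straight_line_embedding V E \<phi> \<longleftrightarrow>
     inj_on \<phi> V \<and>
     (\<forall>u v x y. {u, v} \<in> E \<and> {x, y} \<in> E \<and> {u, v} \<noteq> {x, y} \<longrightarrow>
        closed_segment (\<phi> u) (\<phi> v) \<inter> closed_segment (\<phi> x) (\<phi> y) \<subseteq> \<phi> ` ({u, v} \<inter> {x, y})) \<and>
     (\<forall>u v w. {u, v} \<in> E \<and> w \<in> V - {u, v} \<longrightarrow> \<phi> w \<notin> closed_segment (\<phi> u) (\<phi> v))"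

definition universal_for :: "(real ^ 2) set \<Rightarrow> ('v set \<times> 'v set set) set \<Rightarrow> bool" where
  "universal_for S \<G> \<longleftrightarrow>
     finite S \<and>
     (\<forall>(V, E) \<in> \<G>. \<exists>\<phi>. plane_straight_line_embedding V E \<phi> \<and> \<phi> ` V \<subseteq> S)"

text \<open>
  The third argument records the faces (including the outer one) of the triangulation built so far,
  each face being given by the set of its three vertices. It is a multiset because the initial
  triangle has two faces, the inner and the outer one, with the same vertices.
\<close>

inductive stacked_with_faces :: "'v set \<Rightarrow> 'v set set \<Rightarrow> 'v set multiset \<Rightarrow> bool" where
  triangle:
    "card {a, b, c} = 3 \<Longrightarrow>
     stacked_with_faces {a, b, c} {{a, b}, {b, c}, {a, c}} {#{a, b, c}, {a, b, c}#}"
| stack: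
    "stacked_with_faces V E F \<Longrightarrow> {a, b, c} \<in># F \<Longrightarrow> v \<notin> V \<Longrightarrow>
     stacked_with_faces (insert v V) (E \<union> {{v, a}, {v, b}, {v, c}})
       (F - {#{a, b, c}#} + {#{v, a, b}, {v, b, c}, {v, a, c}#})"

text \<open>
  Vertices are natural numbers; up to isomorphism this covers all finite graphs.
\<close>

definition stacked_triangulations :: "nat \<Rightarrow> (nat set \<times> nat set set) set" where
  "stacked_triangulations n = {(V, E). card V = n \<and> (\<exists>F. stacked_with_faces V E F)}"

definition f_s :: "nat \<Rightarrow> nat" where
  "f_s n = (LEAST m. \<exists>S. universal_for S (stacked_triangulations n) \<and> card S = m)"

end

theory Submission
  imports Defs "HOL-Real_Asymp.Real_Asymp"
begin

text \<open>
  Label the vertices of a stacked triangulation on \<open>n \<ge> 4\<close> vertices in the order of insertion. There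
  are \<open>2 ^ (n - 4) * (n - 3)!\<close> such labelled graphs, since a triangulation on \<open>k \<ge> 4\<close> vertices
  has \<open>2 k - 4\<close> faces to insert the next vertex into. A placement of the labels at points of \<open>S\<close>
  is a plane embedding of at most one of them, because the position of a new vertex determines the
  face that it was inserted into. Hence there are at most \<open>n! * (card S choose n)\<close> of them, so
  \<open>card S choose n\<close> is at least \<open>2 ^ n\<close> up to a polynomial factor, and the bound
  \<open>(m choose n) * x ^ n \<le> (1 + x) ^ m\<close> with \<open>x = 1 / (\<alpha> - 1)\<close> gives the claim.

  That the face is determined is a parity argument. Every point off the drawing lies in an even
  number of the (closed) triangles spanned by the faces, whereas an odd number of faces contain all
  the other vertices. If a new vertex could be joined without crossings to the vertices of two
  different faces, then for each face it would lie on the same side as the vertices not on that face,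
  contradicting the two parities.

  The definition of \<open>f_s\<close> by \<open>LEAST\<close> is meaningful only if universal sets exist, so it must also be
  shown that stacked triangulations have plane straight-line embeddings. For this the outer face may
  be any prescribed face, which is the invariant that makes insertion into the outer face work.
\<close>

section \<open>Triangles in the plane\<close>

text \<open>
  Whether the segment from \<open>a\<close> to \<open>b\<close> meets the vertical ray below \<open>p\<close>. The half-open condition
  on the first coordinates makes vertices on the ray count consistently, so that no general
  position assumption is needed.
\<close>

definition ray_crosses :: "real ^ 2 \<Rightarrow> real ^ 2 \<Rightarrow> real ^ 2 \<Rightarrow> bool" where
  "ray_crosses a b p \<longleftrightarrow>
     a $ 1 \<le> p $ 1 \<and> p $ 1 < b $ 1 \<and>
       (b $ 1 - a $ 1) * (p $ 2 - a $ 2) > (p $ 1 - a $ 1) * (b $ 2 - a $ 2) \<or>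
     b $ 1 \<le> p $ 1 \<and> p $ 1 < a $ 1 \<and>
       (a $ 1 - b $ 1) * (p $ 2 - b $ 2) > (p $ 1 - b $ 1) * (a $ 2 - b $ 2)"

text \<open>The apex is the origin, and \<open>P\<close> is no further right than \<open>B\<close>
  and \<open>C\<close>. This makes \<open>\<beta> + \<gamma> \<le> 1\<close> automatic, so the
  triangle can be replaced by the cone at its apex. Membership in the cone means that
  \<open>P\<close> lies above exactly one of its two bounding rays, which the signs of two
  determinants express.\<close>

lemma in_cone_iff_scalar:
  fixes B1 B2 C1 C2 P1 P2 :: real
  assumes "0 \<le> P1" "P1 \<le> B1" "P1 \<le> C1" "0 < B1" "0 < C1"
    and X: "B1 * P2 - P1 * B2 \<noteq> 0" and Y: "C1 * P2 - P1 * C2 \<noteq> 0"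
  shows "(\<exists>\<beta> \<gamma>. 0 \<le> \<beta> \<and> 0 \<le> \<gamma> \<and> \<beta> + \<gamma> \<le> 1 \<and> P1 = \<beta> * B1 + \<gamma> * C1 \<and> P2 = \<beta> * B2 + \<gamma> * C2)
     \<longleftrightarrow> (B1 * P2 - P1 * B2 > 0) \<noteq> (C1 * P2 - P1 * C2 > 0)"
proof
  assume "\<exists>\<beta> \<gamma>. 0 \<le> \<beta> \<and> 0 \<le> \<gamma> \<and> \<beta> + \<gamma> \<le> 1 \<and> P1 = \<beta> * B1 + \<gamma> * C1 \<and> P2 = \<beta> * B2 + \<gamma> * C2"
  then obtain \<beta> \<gamma> where *: "0 \<le> \<beta>" "0 \<le> \<gamma>" "P1 = \<beta> * B1 + \<gamma> * C1" "P2 = \<beta> * B2 + \<gamma> * C2"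
    by blast
  define K where "K = B1 * C2 - C1 * B2"
  have X1: "B1 * P2 - P1 * B2 = \<gamma> * K" and Y1: "C1 * P2 - P1 * C2 = - \<beta> * K"
    unfolding K_def *(3,4) by algebra+
  have nz: "\<gamma> \<noteq> 0" "\<beta> \<noteq> 0" "K \<noteq> 0" using X Y X1 Y1 by auto
  with * have pos: "\<gamma> > 0" "\<beta> > 0" by auto
  show "(B1 * P2 - P1 * B2 > 0) \<noteq> (C1 * P2 - P1 * C2 > 0)"
    unfolding X1 Y1 using nz pos by (simp add: zero_less_mult_iff mult_less_0_iff) argo
next
  assume *: "(B1 * P2 - P1 * B2 > 0) \<noteq> (C1 * P2 - P1 * C2 > 0)"
  \<comment> \<open>By Cramer's rule the coefficients are \<open>- Y / K\<close> and
    \<open>X / K\<close>. The identity \<open>id\<close> gives \<open>K\<close> the sign of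
    \<open>X\<close>, so both are nonnegative.\<close>
  define K where "K = B1 * C2 - C1 * B2"
  define X where "X = B1 * P2 - P1 * B2"
  define Y where "Y = C1 * P2 - P1 * C2"
  have id: "C1 * X - B1 * Y = P1 * K" unfolding X_def Y_def K_def by algebra
  have XY: "X > 0 \<and> Y < 0 \<or> X < 0 \<and> Y > 0"
    using * assms(6,7) unfolding X_def Y_def by linarith
  have K: "X / K \<ge> 0 \<and> - Y / K \<ge> 0 \<and> K \<noteq> 0"
    using XY
  proof
    assume a: "X > 0 \<and> Y < 0"
    have "P1 * K > 0"
      unfolding id[symmetric] using a assms(4,5) mult_pos_pos[of C1 X] mult_pos_neg[of B1 Y] by linarith
    with assms(1) have "K > 0" by (simp add: zero_less_mult_iff)
    with a show ?thesis by (simp add: divide_nonneg_pos divide_nonpos_pos)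
  next
    assume a: "X < 0 \<and> Y > 0"
    have "P1 * K < 0"
      unfolding id[symmetric] using a assms(4,5) mult_pos_neg[of C1 X] mult_pos_pos[of B1 Y] by linarith
    with assms(1) have "K < 0" by (simp add: mult_less_0_iff)
    with a show ?thesis by (simp add: divide_nonneg_neg divide_nonpos_neg)
  qed
  have P1: "P1 = (- Y / K) * B1 + (X / K) * C1"
    using K id by (simp add: field_simps)
  have "K * P2 = - Y * B2 + X * C2" unfolding X_def Y_def K_def by algebra
  then have P2: "P2 = (- Y / K) * B2 + (X / K) * C2"
    using K by (simp add: field_simps)
  have "- Y / K + X / K \<le> 1"
  proof (rule ccontr)
    assume n: "\<not> - Y / K + X / K \<le> 1"
    \<comment> \<open>If the coefficients summed to more than 1, the first coordinate of
      \<open>P\<close> would exceed that of the nearer of \<open>B\<close> and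
      \<open>C\<close>.\<close>
    define m where "m = min B1 C1"
    have m: "m > 0" "m \<ge> P1" "m \<le> B1" "m \<le> C1" using assms by (auto simp: m_def)
    have "P1 \<ge> (- Y / K) * m + (X / K) * m"
      unfolding P1 using K m by (intro add_mono mult_left_mono) auto
    also have "(- Y / K) * m + (X / K) * m = (- Y / K + X / K) * m" by algebra
    finally have "P1 \<ge> (- Y / K + X / K) * m" .
    moreover have "(- Y / K + X / K) * m > 1 * m"
      using n m by (intro mult_strict_right_mono) auto
    ultimately show False using m by linarith
  qed
  with K P1 P2
  show "\<exists>\<beta> \<gamma>. 0 \<le> \<beta> \<and> 0 \<le> \<gamma> \<and> \<beta> + \<gamma> \<le> 1 \<and> P1 = \<beta> * B1 + \<gamma> * C1 \<and> P2 = \<beta> * B2 + \<gamma> * C2"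
    by blast
qed

text \<open>The factor \<open>s\<close> is later 1 or -1. The value -1 reflects the plane in a
  vertical line, so an apex to the right of \<open>p\<close> is treated by the same argument as one
  to the left.\<close>

lemma in_triangle_iff_scalar:
  fixes a b c p :: "real ^ 2"
  assumes "s \<noteq> 0"
  shows "p \<in> convex hull {a, b, c} \<longleftrightarrow> (\<exists>\<beta> \<gamma>. 0 \<le> \<beta> \<and> 0 \<le> \<gamma> \<and> \<beta> + \<gamma> \<le> 1 \<and>
    s * (p $ 1 - a $ 1) = \<beta> * (s * (b $ 1 - a $ 1)) + \<gamma> * (s * (c $ 1 - a $ 1)) \<and>
    p $ 2 - a $ 2 = \<beta> * (b $ 2 - a $ 2) + \<gamma> * (c $ 2 - a $ 2))"
proof -
  have "s * x = \<beta> * (s * y) + \<gamma> * (s * z) \<longleftrightarrow> x = \<beta> * y + \<gamma> * z" for x y z \<beta> \<gamma> :: real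
  proof -
    have "\<beta> * (s * y) + \<gamma> * (s * z) = s * (\<beta> * y + \<gamma> * z)" by algebra
    with assms show ?thesis by simp
  qed
  moreover have "p = a + u *\<^sub>R (b - a) + v *\<^sub>R (c - a) \<longleftrightarrow>
      p $ 1 - a $ 1 = u * (b $ 1 - a $ 1) + v * (c $ 1 - a $ 1) \<and>
      p $ 2 - a $ 2 = u * (b $ 2 - a $ 2) + v * (c $ 2 - a $ 2)" for u v
    by (auto simp: vec_eq_iff forall_2)
  ultimately show ?thesis
    unfolding convex_hull_3_alt by auto
qed

text \<open>Used in contrapositive form: a point off the sides at the apex has the nonzero
  determinants that \<open>in_cone_iff_scalar\<close> asks for.\<close>

lemma on_segment_scalar:
  fixes a b p :: "real ^ 2"
  assumes "s \<noteq> 0" "0 \<le> s * (p $ 1 - a $ 1)" "s * (p $ 1 - a $ 1) \<le> s * (b $ 1 - a $ 1)"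
    "0 < s * (b $ 1 - a $ 1)"
    "s * (b $ 1 - a $ 1) * (p $ 2 - a $ 2) - s * (p $ 1 - a $ 1) * (b $ 2 - a $ 2) = 0"
  shows "p \<in> closed_segment a b"
proof -
  define u where "u = (s * (p $ 1 - a $ 1)) / (s * (b $ 1 - a $ 1))"
  have u: "0 \<le> u" "u \<le> 1" unfolding u_def using assms(2-4) by (metis divide_nonneg_pos, metis divide_le_eq_1_pos)
  have nz: "b $ 1 - a $ 1 \<noteq> 0" using assms by auto
  have u': "u = (p $ 1 - a $ 1) / (b $ 1 - a $ 1)" using assms(1) by (simp add: u_def)
  have e1: "p $ 1 - a $ 1 = u * (b $ 1 - a $ 1)" using nz by (simp add: u')
  have "s * ((b $ 1 - a $ 1) * (p $ 2 - a $ 2) - (p $ 1 - a $ 1) * (b $ 2 - a $ 2)) = 0"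
    using assms(5) by (simp add: algebra_simps)
  with assms(1) have "(b $ 1 - a $ 1) * (p $ 2 - a $ 2) = (p $ 1 - a $ 1) * (b $ 2 - a $ 2)" by simp
  then have e2: "p $ 2 - a $ 2 = u * (b $ 2 - a $ 2)" using nz by (simp add: u' field_simps)
  have "p = (1 - u) *\<^sub>R a + u *\<^sub>R b"
    using e1 e2 by (simp add: vec_eq_iff forall_2 algebra_simps)
  with u show ?thesis unfolding closed_segment_def by blast
qed

lemma in_triangle_iff_apex:
  fixes a b c p :: "real ^ 2"
  assumes "s = 1 \<or> s = -1" "0 \<le> s * (p $ 1 - a $ 1)"
    "s * (p $ 1 - a $ 1) \<le> s * (b $ 1 - a $ 1)" "0 < s * (b $ 1 - a $ 1)"
    "s * (p $ 1 - a $ 1) \<le> s * (c $ 1 - a $ 1)" "0 < s * (c $ 1 - a $ 1)"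
    and "p \<notin> closed_segment a b" "p \<notin> closed_segment a c"
  shows "p \<in> convex hull {a, b, c} \<longleftrightarrow>
    (s * (b $ 1 - a $ 1) * (p $ 2 - a $ 2) - s * (p $ 1 - a $ 1) * (b $ 2 - a $ 2) > 0) \<noteq>
    (s * (c $ 1 - a $ 1) * (p $ 2 - a $ 2) - s * (p $ 1 - a $ 1) * (c $ 2 - a $ 2) > 0)"
proof -
  have s: "s \<noteq> 0" using assms(1) by auto
  show ?thesis
    unfolding in_triangle_iff_scalar[OF s]
    by (rule in_cone_iff_scalar) (use assms on_segment_scalar[OF s] in blast)+
qed

lemma in_triangle_iff_left_apex:
  fixes a b c p :: "real ^ 2"
  assumes "a $ 1 \<le> p $ 1" "p $ 1 < b $ 1" "p $ 1 < c $ 1"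
    and "p \<notin> closed_segment a b" "p \<notin> closed_segment a c"
  shows "p \<in> convex hull {a, b, c} \<longleftrightarrow> ray_crosses a b p \<noteq> ray_crosses a c p"
  using in_triangle_iff_apex[of 1 p a b c] assms unfolding ray_crosses_def by auto

lemma in_triangle_iff_right_apex:
  fixes a b c p :: "real ^ 2"
  assumes "p $ 1 < a $ 1" "b $ 1 \<le> p $ 1" "c $ 1 \<le> p $ 1"
    and "p \<notin> closed_segment a b" "p \<notin> closed_segment a c"
  shows "p \<in> convex hull {a, b, c} \<longleftrightarrow> ray_crosses a b p \<noteq> ray_crosses a c p"
proof -
  have *: "(-1) * (b $ 1 - a $ 1) * (p $ 2 - a $ 2) - (-1) * (p $ 1 - a $ 1) * (b $ 2 - a $ 2)
    = (a $ 1 - b $ 1) * (p $ 2 - b $ 2) - (p $ 1 - b $ 1) * (a $ 2 - b $ 2)" for b :: "real ^ 2"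
    by algebra
  show ?thesis
    using in_triangle_iff_apex[of "-1" p a b c] assms unfolding ray_crosses_def * by auto
qed

text \<open>This is the parity criterion for triangles. The cases say which vertices lie strictly to
  the right of the vertical line through \<open>p\<close>. A vertex alone on its side serves as the
  apex, and the ray does not cross the edge opposite it. If all vertices are on one side, nothing is
  crossed and \<open>p\<close> is outside.\<close>

lemma in_triangle_iff_ray_crosses:
  fixes a b c p :: "real ^ 2"
  assumes "p \<notin> closed_segment a b" "p \<notin> closed_segment b c" "p \<notin> closed_segment a c"
  shows "p \<in> convex hull {a, b, c} \<longleftrightarrow>
    ray_crosses a b p \<noteq> (ray_crosses b c p \<noteq> ray_crosses a c p)"
proof -
  have seg: "p \<notin> closed_segment b a" "p \<notin> closed_segment c b" "p \<notin> closed_segment c a"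
    using assms by (simp_all add: closed_segment_commute)
  have perm: "{b, a, c} = {a, b, c}" "{c, a, b} = {a, b, c}" by auto
  consider (right) "p $ 1 < a $ 1" "p $ 1 < b $ 1" "p $ 1 < c $ 1"
    | (left) "a $ 1 \<le> p $ 1" "b $ 1 \<le> p $ 1" "c $ 1 \<le> p $ 1"
    | (la) "a $ 1 \<le> p $ 1" "p $ 1 < b $ 1" "p $ 1 < c $ 1"
    | (lb) "b $ 1 \<le> p $ 1" "p $ 1 < a $ 1" "p $ 1 < c $ 1"
    | (lc) "c $ 1 \<le> p $ 1" "p $ 1 < a $ 1" "p $ 1 < b $ 1"
    | (ra) "p $ 1 < a $ 1" "b $ 1 \<le> p $ 1" "c $ 1 \<le> p $ 1"
    | (rb) "p $ 1 < b $ 1" "a $ 1 \<le> p $ 1" "c $ 1 \<le> p $ 1"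
    | (rc) "p $ 1 < c $ 1" "a $ 1 \<le> p $ 1" "b $ 1 \<le> p $ 1"
    by linarith
  then show ?thesis
  proof cases
    case right
    have "convex hull {a, b, c} \<subseteq> {x. inner (axis 1 1) x > p $ 1}"
      using right by (intro hull_minimal convex_halfspace_gt) (auto simp: inner_axis')
    then have "p \<notin> convex hull {a, b, c}" by (auto simp: inner_axis')
    with right show ?thesis by (auto simp: ray_crosses_def)
  next
    case left
    \<comment> \<open>The inequalities are weak here, so a half-plane does not separate
      \<open>p\<close> from the triangle. Instead a convex combination equal to \<open>p\<close>
      yields three nonnegative terms with sum zero, all of which vanish.\<close>
    have "p \<notin> convex hull {a, b, c}"
    proof
      assume "p \<in> convex hull {a, b, c}"
      then obtain u v w where uvw: "0 \<le> u" "0 \<le> v" "0 \<le> w" "u + v + w = 1"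
        "p = u *\<^sub>R a + v *\<^sub>R b + w *\<^sub>R c"
        unfolding convex_hull_3 by blast
      have "u * (p $ 1 - a $ 1) + v * (p $ 1 - b $ 1) + w * (p $ 1 - c $ 1) = (u + v + w) * p $ 1 - (u *\<^sub>R a + v *\<^sub>R b + w *\<^sub>R c) $ 1"
        by (simp add: algebra_simps)
      also have "\<dots> = 0" using uvw by simp
      finally have s0: "u * (p $ 1 - a $ 1) + v * (p $ 1 - b $ 1) + w * (p $ 1 - c $ 1) = 0" .
      have nn: "u * (p $ 1 - a $ 1) \<ge> 0" "v * (p $ 1 - b $ 1) \<ge> 0" "w * (p $ 1 - c $ 1) \<ge> 0"
        using uvw left by auto
      have z: "u = 0 \<or> p $ 1 = a $ 1" "v = 0 \<or> p $ 1 = b $ 1" "w = 0 \<or> p $ 1 = c $ 1"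
        using s0 nn by (smt (verit) mult_eq_0_iff)+
      show False
      proof (cases "u = 0 \<or> v = 0 \<or> w = 0")
        case True
        then show False
        proof (elim disjE)
          assume "u = 0"
          with uvw have "p = (1 - w) *\<^sub>R b + w *\<^sub>R c" by (auto simp: algebra_simps) (metis add.commute add_diff_cancel_left' scaleR_left_distrib scaleR_one)
          with uvw \<open>u = 0\<close> have "p \<in> closed_segment b c" unfolding closed_segment_def by auto
          with assms show False by simp
        next
          assume "v = 0"
          with uvw have "p = (1 - w) *\<^sub>R a + w *\<^sub>R c" by (auto simp: algebra_simps) (metis add.commute add_diff_cancel_left' scaleR_left_distrib scaleR_one)
          with uvw \<open>v = 0\<close> have "p \<in> closed_segment a c" unfolding closed_segment_def by auto
          with assms show False by simp
        next
          assume "w = 0"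
          with uvw have "p = (1 - v) *\<^sub>R a + v *\<^sub>R b" by (auto simp: algebra_simps) (metis add.commute add_diff_cancel_left' scaleR_left_distrib scaleR_one)
          with uvw \<open>w = 0\<close> have "p \<in> closed_segment a b" unfolding closed_segment_def by auto
          with assms show False by simp
        qed
      next
        case False
        \<comment> \<open>All weights are positive, so the triangle degenerates to a vertical
          segment through \<open>p\<close>. As \<open>p\<close> is neither below all vertices nor
          above all of them, it lies between two of them and hence on an edge.\<close>
        then have eq: "p $ 1 = a $ 1" "p $ 1 = b $ 1" "p $ 1 = c $ 1" using z by auto
        have key: "p \<in> closed_segment q r"
          if "q $ 1 = p $ 1" "r $ 1 = p $ 1" "q $ 2 \<le> p $ 2" "p $ 2 \<le> r $ 2" for q r :: "real ^ 2"
        proof -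
          have "p $ 2 \<in> closed_segment (q $ 2) (r $ 2)" using that by (simp add: closed_segment_eq_real_ivl)
          then obtain t where t: "0 \<le> t" "t \<le> 1" "p $ 2 = (1 - t) * q $ 2 + t * r $ 2"
            unfolding closed_segment_def by auto
          have "p = (1 - t) *\<^sub>R q + t *\<^sub>R r"
            using t that by (simp add: vec_eq_iff forall_2 algebra_simps)
          with t show ?thesis unfolding closed_segment_def by blast
        qed
        have p2: "p $ 2 = u * a $ 2 + v * b $ 2 + w * c $ 2" using uvw by simp
        have "\<not> (p $ 2 < a $ 2 \<and> p $ 2 < b $ 2 \<and> p $ 2 < c $ 2)"
        proof
          assume A: "p $ 2 < a $ 2 \<and> p $ 2 < b $ 2 \<and> p $ 2 < c $ 2"
          have "u * (a $ 2 - p $ 2) + v * (b $ 2 - p $ 2) + w * (c $ 2 - p $ 2) > 0"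
            using A uvw False by (intro add_pos_pos mult_pos_pos) auto
          moreover have "u * (a $ 2 - p $ 2) + v * (b $ 2 - p $ 2) + w * (c $ 2 - p $ 2)
            = p $ 2 - (u + v + w) * p $ 2" by (subst (4) p2) algebra
          ultimately show False using uvw by simp
        qed
        moreover have "\<not> (p $ 2 > a $ 2 \<and> p $ 2 > b $ 2 \<and> p $ 2 > c $ 2)"
        proof
          assume A: "p $ 2 > a $ 2 \<and> p $ 2 > b $ 2 \<and> p $ 2 > c $ 2"
          have "u * (p $ 2 - a $ 2) + v * (p $ 2 - b $ 2) + w * (p $ 2 - c $ 2) > 0"
            using A uvw False by (intro add_pos_pos mult_pos_pos) auto
          moreover have "u * (p $ 2 - a $ 2) + v * (p $ 2 - b $ 2) + w * (p $ 2 - c $ 2)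
            = (u + v + w) * p $ 2 - p $ 2" by (subst (5) p2) algebra
          ultimately show False using uvw by simp
        qed
        ultimately show False
          using key[of a b] key[of b a] key[of b c] key[of c b] key[of a c] key[of c a] eq seg assms
          by (smt (verit))
      qed
    qed
    with left show ?thesis by (auto simp: ray_crosses_def)
  next
    case la
    then show ?thesis
      using in_triangle_iff_left_apex[of a p b c] assms by (auto simp: ray_crosses_def)
  next
    case lb
    then show ?thesis
      using in_triangle_iff_left_apex[of b p a c] assms seg unfolding perm
      by (auto simp: ray_crosses_def)
  next
    case lc
    then show ?thesis
      using in_triangle_iff_left_apex[of c p a b] assms seg unfolding perm
      by (auto simp: ray_crosses_def)
  next
    case ra
    then show ?thesis
      using in_triangle_iff_right_apex[of p a b c] assms by (auto simp: ray_crosses_def)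
  next
    case rb
    then show ?thesis
      using in_triangle_iff_right_apex[of p b a c] assms seg unfolding perm
      by (auto simp: ray_crosses_def)
  next
    case rc
    then show ?thesis
      using in_triangle_iff_right_apex[of p c a b] assms seg unfolding perm
      by (auto simp: ray_crosses_def)
  qed
qed

text \<open>Each of the six segments is a side of exactly two of the four triangles, so the ray
  crossings cancel modulo 2. The nested equivalence on the right is an exclusive or.\<close>

lemma four_triangles_parity:
  fixes a b c v p :: "real ^ 2"
  assumes "p \<notin> closed_segment a b" "p \<notin> closed_segment b c" "p \<notin> closed_segment a c"
    "p \<notin> closed_segment v a" "p \<notin> closed_segment v b" "p \<notin> closed_segment v c"
  shows "p \<in> convex hull {a, b, c} \<longleftrightarrow>
    (p \<in> convex hull {v, a, b} \<longleftrightarrow> (p \<in> convex hull {v, b, c} \<longleftrightarrow> p \<in> convex hull {v, a, c}))"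
  using in_triangle_iff_ray_crosses[of p a b c] in_triangle_iff_ray_crosses[of p v a b]
    in_triangle_iff_ray_crosses[of p v b c] in_triangle_iff_ray_crosses[of p v a c] assms
  by blast

section \<open>Segments against triangles, and four points in the plane\<close>

lemma segment_avoiding_triangle_boundary:
  fixes a b c p q :: "real ^ 2"
  assumes "closed_segment p q \<inter> closed_segment a b = {}" "closed_segment p q \<inter> closed_segment b c = {}"
    "closed_segment p q \<inter> closed_segment a c = {}"
  shows "p \<in> convex hull {a, b, c} \<longleftrightarrow> q \<in> convex hull {a, b, c}"
proof (rule ccontr)
  assume *: "\<not> ?thesis"
  have "closed_segment p q \<inter> frontier (convex hull {a, b, c}) \<noteq> {}"
  proof (rule connected_Int_frontier)
    show "connected (closed_segment p q)" by simp
    show "closed_segment p q \<inter> convex hull {a, b, c} \<noteq> {}"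
      using * by (metis IntI empty_iff ends_in_segment)
    show "closed_segment p q - convex hull {a, b, c} \<noteq> {}"
      using * by (metis DiffI empty_iff ends_in_segment)
  qed
  with assms show False by (auto simp: frontier_of_triangle closed_segment_commute)
qed

text \<open>The point \<open>c\<close> is extreme in the triangle \<open>a b c\<close>, hence also
  in the subset spanned by \<open>a b d\<close> if it lies there. It would then be one of
  \<open>a\<close>, \<open>b\<close>, \<open>d\<close>.\<close>

lemma not_both_in_triangle:
  fixes a b c d :: "real ^ 2"
  assumes "\<not> collinear {a, b, c}" "d \<in> convex hull {a, b, c}" "c \<notin> {a, b, d}"
  shows "c \<notin> convex hull {a, b, d}"
proof
  assume c: "c \<in> convex hull {a, b, d}"
  have "\<not> affine_dependent {a, b, c}" using assms(1) collinear_3_eq_affine_dependent by auto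
  then have "c extreme_point_of (convex hull {a, b, c})"
    by (simp add: extreme_point_of_convex_hull_affine_independent)
  moreover have "convex hull {a, b, d} \<subseteq> convex hull {a, b, c}"
    using assms(2) by (intro hull_minimal) (auto simp: hull_inc)
  ultimately have "c extreme_point_of (convex hull {a, b, d})"
    using c unfolding extreme_point_of_def by blast
  then have "c \<in> {a, b, d}" by (rule extreme_point_of_convex_hull)
  with assms(3) show False by simp
qed

lemma not_collinear_if_not_between:
  fixes a b c :: "'a::euclidean_space"
  assumes "a \<notin> closed_segment b c" "b \<notin> closed_segment a c" "c \<notin> closed_segment a b"
  shows "\<not> collinear {a, b, c}"
  using assms by (auto simp: collinear_between_cases between_mem_segment closed_segment_commute)

text \<open>By Radon's theorem at least one of the points lies in the triangle of the other three;
  it is unique because the other three are then the extreme points of the hull.\<close>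

lemma plane_K4_parity:
  fixes a b c d :: "real ^ 2"
  assumes ndeg: "a \<notin> closed_segment b c" "a \<notin> closed_segment b d" "a \<notin> closed_segment c d"
    "b \<notin> closed_segment a c" "b \<notin> closed_segment a d" "b \<notin> closed_segment c d"
    "c \<notin> closed_segment a b" "c \<notin> closed_segment a d" "c \<notin> closed_segment b d"
    "d \<notin> closed_segment a b" "d \<notin> closed_segment a c" "d \<notin> closed_segment b c"
    and cross: "closed_segment a b \<inter> closed_segment c d = {}"
    "closed_segment a c \<inter> closed_segment b d = {}" "closed_segment b c \<inter> closed_segment a d = {}"
  shows "d \<in> convex hull {a, b, c} \<longleftrightarrow>
    \<not> (c \<in> convex hull {d, a, b} \<longleftrightarrow> (a \<in> convex hull {d, b, c} \<longleftrightarrow> b \<in> convex hull {d, a, c}))"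
proof -
  have dist: "a \<noteq> b" "a \<noteq> c" "a \<noteq> d" "b \<noteq> c" "b \<noteq> d" "c \<noteq> d"
    using ndeg by auto
  have nc: "\<not> collinear {a, b, c}" "\<not> collinear {a, b, d}" "\<not> collinear {a, c, d}" "\<not> collinear {b, c, d}"
    using ndeg not_collinear_if_not_between[of a b c] not_collinear_if_not_between[of a b d]
      not_collinear_if_not_between[of a c d] not_collinear_if_not_between[of b c d] by blast+
  have perm: "{d, a, b} = {a, b, d}" "{d, b, c} = {b, c, d}" "{d, a, c} = {a, c, d}" by auto
  let ?D = "d \<in> convex hull {a, b, c}" and ?C = "c \<in> convex hull {a, b, d}"
  let ?B = "b \<in> convex hull {a, c, d}" and ?A = "a \<in> convex hull {b, c, d}"
  have DC: "\<not> (?D \<and> ?C)" using not_both_in_triangle[of a b c d] nc dist by auto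
  have DB: "\<not> (?D \<and> ?B)" using not_both_in_triangle[of a c b d] nc dist by (auto simp: insert_commute)
  have DA: "\<not> (?D \<and> ?A)" using not_both_in_triangle[of b c a d] nc dist by (auto simp: insert_commute)
  have CB: "\<not> (?C \<and> ?B)" using not_both_in_triangle[of a d b c] nc dist by (auto simp: insert_commute)
  have CA: "\<not> (?C \<and> ?A)" using not_both_in_triangle[of b d a c] nc dist by (auto simp: insert_commute)
  have BA: "\<not> (?B \<and> ?A)" using not_both_in_triangle[of c d a b] nc dist by (auto simp: insert_commute)
  have "?A \<or> ?B \<or> ?C \<or> ?D"
  proof (rule ccontr)
    assume no: "\<not> (?A \<or> ?B \<or> ?C \<or> ?D)"
    have "card {a, b, c, d} = 4" using dist by simp
    then have "affine_dependent {a, b, c, d}" by (intro affine_dependent_biggerset) auto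
    then obtain M P where MP: "M \<inter> P = {}" "M \<union> P = {a, b, c, d}" "convex hull M \<inter> convex hull P \<noteq> {}"
      using Radon_partition[of "{a, b, c, d}"] by auto
    \<comment> \<open>An empty part has empty hull, a partition into one and three points puts a
      point into a triangle, and one into two pairs makes two opposite edges cross.\<close>
    have wl: False if "M \<inter> P = {}" "M \<union> P = {a, b, c, d}" "convex hull M \<inter> convex hull P \<noteq> {}" "a \<in> M" for M P
    proof -
      have M: "M = {a, b, c, d} - P" and P: "P \<subseteq> {b, c, d}" using that by auto
      have "P \<in> Pow {b, c, d}" using P by simp
      then have "P \<in> {{}, {b}, {c}, {d}, {b, c}, {b, d}, {c, d}, {b, c, d}}"
        by (simp add: Pow_insert) blast
      then show False
        using that(3) no cross dist unfolding M
        by (auto simp: insert_Diff_if segment_convex_hull[symmetric] insert_commute Int_commute)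
    qed
    from MP have "a \<in> M \<or> a \<in> P" by blast
    with MP wl[of M P] wl[of P M] show False by (auto simp: Int_commute Un_commute)
  qed
  with DC DB DA CB CA BA show ?thesis unfolding perm by blast
qed

section \<open>Plane straight-line embeddings\<close>

lemma embedding_mono:
  assumes "plane_straight_line_embedding V' E' \<phi>" "V \<subseteq> V'" "E \<subseteq> E'"
  shows "plane_straight_line_embedding V E \<phi>"
  using assms unfolding plane_straight_line_embedding_def
  by (meson Diff_mono inj_on_subset subset_iff order_refl)

lemma embedding_cong:
  assumes "\<And>v. v \<in> V \<Longrightarrow> \<phi> v = \<psi> v" "\<And>e. e \<in> E \<Longrightarrow> e \<subseteq> V"
    and emb: "plane_straight_line_embedding V E \<phi>"
  shows "plane_straight_line_embedding V E \<psi>"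
  unfolding plane_straight_line_embedding_def
proof (intro conjI allI impI)
  show "inj_on \<psi> V"
    using emb assms(1) unfolding plane_straight_line_embedding_def by (simp cong: inj_on_cong)
next
  fix u v x y assume *: "{u, v} \<in> E \<and> {x, y} \<in> E \<and> {u, v} \<noteq> {x, y}"
  then have V: "u \<in> V" "v \<in> V" "x \<in> V" "y \<in> V" using assms(2) by blast+
  have "\<psi> ` ({u, v} \<inter> {x, y}) = \<phi> ` ({u, v} \<inter> {x, y})"
    using V assms(1) by (intro image_cong) auto
  then show "closed_segment (\<psi> u) (\<psi> v) \<inter> closed_segment (\<psi> x) (\<psi> y) \<subseteq> \<psi> ` ({u, v} \<inter> {x, y})"
    using emb * V assms(1) unfolding plane_straight_line_embedding_def by metis
next
  fix u v w assume *: "{u, v} \<in> E \<and> w \<in> V - {u, v}"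
  then have "u \<in> V" "v \<in> V" using assms(2) by blast+
  then show "\<psi> w \<notin> closed_segment (\<psi> u) (\<psi> v)"
    using emb * assms(1) unfolding plane_straight_line_embedding_def by (metis DiffD1)
qed

lemma embedding_disjoint_edges:
  assumes "plane_straight_line_embedding V E \<phi>" "{u, v} \<in> E" "{x, y} \<in> E" "{u, v} \<inter> {x, y} = {}"
  shows "closed_segment (\<phi> u) (\<phi> v) \<inter> closed_segment (\<phi> x) (\<phi> y) = {}"
proof -
  have "{u, v} \<noteq> {x, y}" using assms(4) by auto
  with assms show ?thesis unfolding plane_straight_line_embedding_def by fastforce
qed

lemma embedding_vertex_off_edge:
  assumes "plane_straight_line_embedding V E \<phi>" "{u, v} \<in> E" "w \<in> V" "w \<noteq> u" "w \<noteq> v"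
  shows "\<phi> w \<notin> closed_segment (\<phi> u) (\<phi> v)"
  using assms unfolding plane_straight_line_embedding_def by blast

text \<open>The edge \<open>{u, w}\<close> shares no vertex with the three edges of the triangle on
  \<open>X\<close>, so its segment avoids the boundary of that triangle.\<close>

lemma embedding_edge_side:
  assumes emb: "plane_straight_line_embedding V E \<phi>"
    and X: "card X = 3" "\<And>u w. u \<in> X \<Longrightarrow> w \<in> X \<Longrightarrow> u \<noteq> w \<Longrightarrow> {u, w} \<in> E"
    and uw: "{u, w} \<in> E" "u \<notin> X" "w \<notin> X"
  shows "\<phi> u \<in> convex hull (\<phi> ` X) \<longleftrightarrow> \<phi> w \<in> convex hull (\<phi> ` X)"
proof -
  obtain a b c where abc: "X = {a, b, c}" "a \<noteq> b" "b \<noteq> c" "a \<noteq> c"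
    using X(1) by (auto simp: card_3_iff)
  have "{a, b} \<in> E" "{b, c} \<in> E" "{a, c} \<in> E" using X(2) abc by auto
  then show ?thesis
    unfolding abc(1) image_insert image_empty
    using uw abc by (intro segment_avoiding_triangle_boundary embedding_disjoint_edges[OF emb]) auto
qed

lemma embedding_K4_parity:
  assumes emb: "plane_straight_line_embedding V E \<phi>"
    and V: "a \<in> V" "b \<in> V" "c \<in> V" "d \<in> V"
    and dist: "a \<noteq> b" "a \<noteq> c" "a \<noteq> d" "b \<noteq> c" "b \<noteq> d" "c \<noteq> d"
    and E: "{a, b} \<in> E" "{a, c} \<in> E" "{b, c} \<in> E" "{d, a} \<in> E" "{d, b} \<in> E" "{d, c} \<in> E"
  shows "\<phi> d \<in> convex hull (\<phi> ` {a, b, c}) \<longleftrightarrow>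
    \<not> (\<phi> c \<in> convex hull (\<phi> ` {d, a, b}) \<longleftrightarrow>
      (\<phi> a \<in> convex hull (\<phi> ` {d, b, c}) \<longleftrightarrow> \<phi> b \<in> convex hull (\<phi> ` {d, a, c})))"
proof -
  have E': "{a, d} \<in> E" "{b, d} \<in> E" "{c, d} \<in> E" using E by (simp_all add: insert_commute)
  note off = embedding_vertex_off_edge[OF emb]
  show ?thesis
    unfolding image_insert image_empty
    by (rule plane_K4_parity)
      (use off[of b c a] off[of b d a] off[of c d a] off[of a c b] off[of a d b] off[of c d b]
        off[of a b c] off[of a d c] off[of b d c] off[of a b d] off[of a c d] off[of b c d]
        embedding_disjoint_edges[OF emb] E E' V dist in auto)
qed

section \<open>Stacked triangulations\<close>

definition stack_edges :: "'v \<Rightarrow> 'v set \<Rightarrow> 'v set set" where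
  "stack_edges v X = (\<lambda>a. {v, a}) ` X"

text \<open>Each new face arises from \<open>X\<close> by exchanging one vertex for
  \<open>v\<close>. This form is symmetric in the vertices of \<open>X\<close>, so no order of them
  has to be chosen.\<close>

definition stack_faces :: "'v \<Rightarrow> 'v set \<Rightarrow> 'v set multiset" where
  "stack_faces v X = image_mset (\<lambda>a. insert v (X - {a})) (mset_set X)"

lemma stack_edges_triangle: "stack_edges v {a, b, c} = {{v, a}, {v, b}, {v, c}}"
  by (auto simp: stack_edges_def)

lemma stack_faces_triangle:
  assumes "a \<noteq> b" "b \<noteq> c" "a \<noteq> c"
  shows "stack_faces v {a, b, c} = {#{v, a, b}, {v, b, c}, {v, a, c}#}"
proof -
  have "mset_set {a, b, c} = {#a, b, c#}" using assms by simp
  moreover have "{a, b, c} - {a} = {b, c}" "{a, b, c} - {b} = {a, c}" "{a, b, c} - {c} = {a, b}"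
    using assms by auto
  ultimately show ?thesis by (simp add: stack_faces_def add_mset_commute)
qed

lemma count_three_le_1:
  assumes "A \<noteq> B" "A \<noteq> C" "B \<noteq> C"
  shows "count {#A, B, C#} X \<le> 1"
  using assms by auto

text \<open>The facts are carried through one induction. That no vertex is isolated is included so
  that vertices can later be located through the edges containing them.\<close>

lemma stacked_with_faces_structure:
  assumes "stacked_with_faces V E F"
  shows "finite V \<and> (\<forall>X\<in>#F. X \<subseteq> V \<and> card X = 3 \<and> (\<forall>u\<in>X. \<forall>w\<in>X. u \<noteq> w \<longrightarrow> {u, w} \<in> E)) \<and>
    (\<forall>e\<in>E. e \<subseteq> V \<and> card e = 2) \<and> (\<forall>u\<in>V. \<exists>e\<in>E. u \<in> e)"
  using assms
proof (induction rule: stacked_with_faces.induct)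
  case (triangle a b c)
  then have "a \<noteq> b" "b \<noteq> c" "a \<noteq> c" by (auto simp: card_insert_if split: if_splits)
  then show ?case by (simp add: doubleton_eq_iff)
next
  case (stack V E F a b c v)
  note face = bspec[OF conjunct1[OF conjunct2[OF stack.IH]] stack.hyps(2)]
  have E: "{u, w} \<in> E" if "u \<in> {a, b, c}" "w \<in> {a, b, c}" "u \<noteq> w" for u w
    by (rule conjunct2[OF conjunct2[OF face], rule_format]) (use that in simp_all)
  have T: "{a, b, c} \<subseteq> V" "card {a, b, c} = 3"
    using conjunct1[OF face] conjunct1[OF conjunct2[OF face]] .
  then have abc: "a \<noteq> b" "b \<noteq> c" "a \<noteq> c" by (auto simp: card_insert_if split: if_splits)
  have v: "v \<noteq> a" "v \<noteq> b" "v \<noteq> c" using T stack.hyps(3) by auto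
  let ?E = "E \<union> {{v, a}, {v, b}, {v, c}}"
  have E2: "{a, b} \<in> E" "{b, a} \<in> E" "{b, c} \<in> E" "{c, b} \<in> E" "{a, c} \<in> E" "{c, a} \<in> E"
    using E[of a b] E[of b a] E[of b c] E[of c b] E[of a c] E[of c a] abc by auto
  have new: "X \<subseteq> insert v V \<and> card X = 3 \<and> (\<forall>u\<in>X. \<forall>w\<in>X. u \<noteq> w \<longrightarrow> {u, w} \<in> ?E)"
    if "X = {v, a, b} \<or> X = {v, b, c} \<or> X = {v, a, c}" for X
    using that T E2 abc v by (elim disjE) (auto simp: insert_commute)
  have faces: "X \<subseteq> insert v V \<and> card X = 3 \<and> (\<forall>u\<in>X. \<forall>w\<in>X. u \<noteq> w \<longrightarrow> {u, w} \<in> ?E)"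
    if X: "X \<in># F - {#{a, b, c}#} + {#{v, a, b}, {v, b, c}, {v, a, c}#}" for X
  proof (cases "X \<in># F - {#{a, b, c}#}")
    case True
    then have "X \<in># F" by (rule in_diffD)
    then show ?thesis using stack.IH by (auto dest: bspec)
  next
    case False
    with X show ?thesis by (intro new) auto
  qed
  have edges: "e \<subseteq> insert v V \<and> card e = 2" if "e \<in> ?E" for e
    using that stack.IH T v by auto
  have incident: "\<exists>e\<in>?E. u \<in> e" if "u \<in> insert v V" for u
    using that stack.IH by auto
  have fin: "finite (insert v V)" using stack.IH by simp
  show ?case
    by (rule conjI[OF fin conjI[OF ballI[OF faces] conjI[OF ballI[OF edges] ballI[OF incident]]]])
qed

lemma
  assumes "stacked_with_faces V E F"
  shows stacked_with_faces_finite: "finite V"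
    and stacked_with_faces_face: "\<And>X. X \<in># F \<Longrightarrow> X \<subseteq> V" "\<And>X. X \<in># F \<Longrightarrow> card X = 3"
      "\<And>X u w. X \<in># F \<Longrightarrow> u \<in> X \<Longrightarrow> w \<in> X \<Longrightarrow> u \<noteq> w \<Longrightarrow> {u, w} \<in> E"
    and stacked_with_faces_edge: "\<And>e. e \<in> E \<Longrightarrow> e \<subseteq> V" "\<And>e. e \<in> E \<Longrightarrow> card e = 2"
    and stacked_with_faces_incident: "\<And>u. u \<in> V \<Longrightarrow> \<exists>e\<in>E. u \<in> e"
  using stacked_with_faces_structure[OF assms] by blast+

lemma stacked_with_faces_step:
  assumes "stacked_with_faces V E F" "X \<in># F" "v \<notin> V" "card X = 3"
  shows "stacked_with_faces (insert v V) (E \<union> stack_edges v X) (F - {#X#} + stack_faces v X)"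
proof -
  obtain a b c where abc: "X = {a, b, c}" "a \<noteq> b" "b \<noteq> c" "a \<noteq> c"
    using assms(4) by (auto simp: card_3_iff)
  then show ?thesis
    using stacked_with_faces.stack[of V E F a b c v] assms by (simp add: stack_edges_triangle stack_faces_triangle)
qed

text \<open>The new faces contain \<open>v\<close>, hence differ from all old ones, and they are
  pairwise distinct. The bound is assumed only after removal of \<open>T\<close> because both faces
  of the initial triangle have the same vertices.\<close>

lemma stacked_with_faces_count_step:
  assumes st: "stacked_with_faces V E F" and T: "T \<in># F" and v: "v \<notin> V"
    and le: "\<And>X. count (F - {#T#}) X \<le> 1"
  shows "count (F - {#T#} + stack_faces v T) X \<le> 1"
proof -
  obtain a b c where abc: "T = {a, b, c}" "a \<noteq> b" "b \<noteq> c" "a \<noteq> c"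
    using stacked_with_faces_face(2)[OF st T] by (auto simp: card_3_iff)
  have va: "v \<noteq> a" "v \<noteq> b" "v \<noteq> c" using stacked_with_faces_face(1)[OF st T] abc(1) v by auto
  have N: "stack_faces v T = {#{v, a, b}, {v, b, c}, {v, a, c}#}"
    unfolding abc(1) using abc(2-4) by (rule stack_faces_triangle)
  show ?thesis
  proof (cases "v \<in> X")
    case True
    then have "X \<notin># F" using stacked_with_faces_face(1)[OF st] v by blast
    then have "count (F - {#T#}) X = 0" by (meson in_diffD not_in_iff)
    moreover have "a \<notin> {v, b, c}" "b \<notin> {v, a, c}" using abc va by auto
    then have "{v, a, b} \<noteq> {v, b, c}" "{v, a, b} \<noteq> {v, a, c}" "{v, b, c} \<noteq> {v, a, c}" by blast+
    then have "count (stack_faces v T) X \<le> 1" unfolding N by (rule count_three_le_1)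
    ultimately show ?thesis unfolding count_union by linarith
  next
    case False
    then have "count (stack_faces v T) X = 0" unfolding N by auto
    then show ?thesis using le[of X] unfolding count_union by linarith
  qed
qed

text \<open>Only the initial triangle has a repeated face, and it is repeated once.\<close>

lemma stacked_with_faces_count:
  "stacked_with_faces V E F \<Longrightarrow> \<forall>T\<in>#F. \<forall>X. count (F - {#T#}) X \<le> 1"
proof (induction rule: stacked_with_faces.induct)
  case (stack V E F a b c v)
  have "card {a, b, c} = 3" using stacked_with_faces_face(2)[OF stack.hyps(1,2)] .
  then have "a \<noteq> b" "b \<noteq> c" "a \<noteq> c" by (auto simp: card_insert_if split: if_splits)
  note N = stack_faces_triangle[OF this, of v, symmetric]
  have "count (F - {#{a, b, c}#} + stack_faces v {a, b, c}) X \<le> 1" for X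
    using stacked_with_faces_count_step[OF stack.hyps] bspec[OF stack.IH stack.hyps(2)] by blast
  then show ?case
    unfolding N by (intro ballI allI order_trans[OF mset_subset_eq_count[OF diff_subset_eq_self]])
qed auto

lemma stacked_with_faces_size:
  "stacked_with_faces V E F \<Longrightarrow> size F = 2 * card V - 4"
proof (induction rule: stacked_with_faces.induct)
  case (stack V E F a b c v)
  have fin: "finite V" using stacked_with_faces_finite[OF stack.hyps(1)] .
  have "card {a, b, c} \<le> card V"
    using stacked_with_faces_face(1)[OF stack.hyps(1,2)] fin by (rule card_mono[rotated])
  \<comment> \<open>This keeps the truncated subtraction in \<open>2 * card V - 4\<close>
    exact.\<close>
  then have "3 \<le> card V" using stacked_with_faces_face(2)[OF stack.hyps(1,2)] by simp
  moreover have "size (F - {#{a, b, c}#}) = size F - 1" using stack.hyps(2) by (rule size_Diff_singleton)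
  ultimately show ?case using stack.IH fin stack.hyps(3) by simp
qed simp

section \<open>Stackings labelled in the order of insertion\<close>

text \<open>The vertex inserted into a graph on \<open>{..<n}\<close> is \<open>n\<close> itself, so
  labels record the order of insertion. The start is at four vertices, where one of the two copies
  of the initial face has been used up and all faces are distinct.\<close>

inductive ordered_stacking :: "nat \<Rightarrow> nat set set \<Rightarrow> nat set multiset \<Rightarrow> bool" where
  base: "ordered_stacking 4 ({{0, 1}, {1, 2}, {0, 2}} \<union> stack_edges 3 {0, 1, 2})
    ({#{0, 1, 2}#} + stack_faces 3 {0, 1, 2})"
| step: "ordered_stacking n E F \<Longrightarrow> X \<in># F \<Longrightarrow>
    ordered_stacking (Suc n) (E \<union> stack_edges n X) (F - {#X#} + stack_faces n X)"

lemma lessThan_4: "{..<4::nat} = {0, 1, 2, 3}" by auto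

lemma ordered_stacking_ge_4: "ordered_stacking n E F \<Longrightarrow> 4 \<le> n"
  by (induction rule: ordered_stacking.induct) auto

lemma stacked_with_faces_012:
  "stacked_with_faces {0, 1, 2::nat} {{0, 1}, {1, 2}, {0, 2}} {#{0, 1, 2}, {0, 1, 2}#}"
  by (rule stacked_with_faces.triangle) simp

lemma ordered_stacking_stacked_with_faces:
  "ordered_stacking n E F \<Longrightarrow> stacked_with_faces {..<n} E F"
proof (induction rule: ordered_stacking.induct)
  case base
  have V: "{..<4::nat} = insert 3 {0, 1, 2}" by auto
  have F: "{#{0, 1, 2}, {0, 1, 2}#} - {#{0, 1, 2::nat}#} = {#{0, 1, 2}#}" by (rule add_mset_remove_trivial)
  show ?case
    unfolding V by (rule stacked_with_faces_step[OF stacked_with_faces_012, of "{0, 1, 2}" 3, unfolded F]) simp_all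
next
  case (step n E F X)
  then show ?case
    unfolding lessThan_Suc by (intro stacked_with_faces_step stacked_with_faces_face(2)) auto
qed

lemmas ordered_stacking_face = stacked_with_faces_face[OF ordered_stacking_stacked_with_faces]
  and ordered_stacking_edge_subset = stacked_with_faces_edge(1)[OF ordered_stacking_stacked_with_faces]

lemma ordered_stacking_face_obtain:
  assumes "ordered_stacking n E F" "X \<in># F"
  obtains a b c where "X = {a, b, c}" "a \<noteq> b" "b \<noteq> c" "a \<noteq> c" "a < n" "b < n" "c < n"
    "{a, b} \<in> E" "{b, c} \<in> E" "{a, c} \<in> E"
proof -
  obtain a b c where abc: "X = {a, b, c}" "a \<noteq> b" "b \<noteq> c" "a \<noteq> c"
    using ordered_stacking_face(2)[OF assms] by (auto simp: card_3_iff)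
  with that[of a b c] ordered_stacking_face(1,3)[OF assms(1), OF assms(2)] show thesis by auto
qed

lemma ordered_stacking_count:
  assumes "ordered_stacking n E F"
  shows "count F X \<le> 1"
  using assms
proof cases
  case base
  have F: "{#{0, 1, 2}, {0, 1, 2}#} - {#{0, 1, 2::nat}#} = {#{0, 1, 2}#}" by (rule add_mset_remove_trivial)
  show ?thesis
    unfolding base
    by (rule stacked_with_faces_count_step[OF stacked_with_faces_012, of "{0, 1, 2}" 3, unfolded F]) simp_all
next
  case (step m E0 F0 Y)
  note st = ordered_stacking_stacked_with_faces[OF step(4)]
  show ?thesis
    unfolding step(3) using stacked_with_faces_count[OF st] step(5)
    by (intro stacked_with_faces_count_step[OF st]) auto
qed

lemma ordered_stacking_face_unique:
  assumes "ordered_stacking n E F" "X \<in># F"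
  shows "X \<notin># F - {#X#}"
proof -
  have "count F X \<le> 1" using ordered_stacking_count[OF assms(1)] .
  then show ?thesis by (simp add: count_eq_zero_iff[symmetric])
qed

section \<open>An embedding determines the stacking\<close>

text \<open>Connectedness of the subgraph induced on \<open>W\<close>, expressed without paths: a
  truth value preserved along its edges is constant. It is applied to the property of lying inside a
  given triangle.\<close>

definition linked :: "'v set set \<Rightarrow> 'v set \<Rightarrow> bool" where
  "linked E W \<longleftrightarrow> (\<forall>f :: 'v \<Rightarrow> bool. (\<forall>u\<in>W. \<forall>w\<in>W. {u, w} \<in> E \<longrightarrow> f u = f w) \<longrightarrow> (\<forall>u\<in>W. \<forall>w\<in>W. f u = f w))"

lemma linkedD:
  assumes "linked E W" "\<And>u w. u \<in> W \<Longrightarrow> w \<in> W \<Longrightarrow> {u, w} \<in> E \<Longrightarrow> f u = f w" "u \<in> W" "w \<in> W"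
  shows "f u = (f w :: bool)"
  using assms unfolding linked_def by blast

lemma linked_mono: "linked E W \<Longrightarrow> E \<subseteq> E' \<Longrightarrow> linked E' W"
  unfolding linked_def by blast

lemma linked_insert:
  assumes "linked E W" "E \<subseteq> E'" "{v, t} \<in> E'" "t \<in> W"
  shows "linked E' (insert v W)"
  unfolding linked_def
proof (intro allI impI ballI)
  fix f :: "_ \<Rightarrow> bool" and u w
  assume f: "\<forall>u\<in>insert v W. \<forall>w\<in>insert v W. {u, w} \<in> E' \<longrightarrow> f u = f w"
    and uw: "u \<in> insert v W" "w \<in> insert v W"
  have "f x = f t" if "x \<in> W" for x
    by (rule linkedD[OF assms(1)]) (use f that assms in auto)
  moreover have "f v = f t" using f assms by auto
  ultimately show "f u = f w" using uw by auto
qed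

lemma linked_complete:
  assumes "\<And>u w. u \<in> W \<Longrightarrow> w \<in> W \<Longrightarrow> u \<noteq> w \<Longrightarrow> {u, w} \<in> E"
  shows "linked E W"
  unfolding linked_def using assms by metis

text \<open>Connectivity of the complement of a new face uses 3-connectivity of the previous graph, so
  both are proved together.\<close>

lemma ordered_stacking_linked:
  "ordered_stacking n E F \<Longrightarrow>
    (\<forall>R. finite R \<and> card R \<le> 2 \<longrightarrow> linked E ({..<n} - R)) \<and> (\<forall>X\<in>#F. linked E ({..<n} - X))"
proof (induction rule: ordered_stacking.induct)
  case base
  have "linked ({{0, 1}, {1, 2}, {0, 2}} \<union> stack_edges 3 {0, 1, 2}) ({..<4} - R)" for R :: "nat set"
    by (rule linked_complete) (auto simp: stack_edges_triangle lessThan_4 doubleton_eq_iff)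
  then show ?case by blast
next
  case (step n E F X)
  let ?E = "E \<union> stack_edges n X"
  obtain a b c where abc: "X = {a, b, c}" "a \<noteq> b" "b \<noteq> c" "a \<noteq> c" "a < n" "b < n" "c < n"
    using ordered_stacking_face_obtain[OF step.hyps] by metis
  have edge: "{n, t} \<in> ?E" if "t \<in> X" for t using that by (auto simp: stack_edges_def)
  have X: "card X = 3" "X \<subseteq> {..<n}" using abc by auto
  have R: "linked ?E ({..<Suc n} - R)" if R: "finite R" "card R \<le> 2" for R
  proof (cases "n \<in> R")
    case True
    then have eq: "{..<Suc n} - R = {..<n} - (R - {n})" by (auto simp: less_Suc_eq)
    have "card (R - {n}) \<le> 2" using R by (meson card_Diff1_le order_trans)
    then show ?thesis unfolding eq using step.IH R(1) by (blast intro: linked_mono)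
  next
    case False
    then have eq: "{..<Suc n} - R = insert n ({..<n} - R)" by (auto simp: less_Suc_eq)
    \<comment> \<open>At most two vertices are removed, so one of the three neighbours of
      \<open>n\<close> survives.\<close>
    have "\<not> X \<subseteq> R" using R X(1) card_mono[of R X] by auto
    then obtain t where "t \<in> X" "t \<notin> R" by blast
    then show ?thesis unfolding eq using step.IH R X edge by (intro linked_insert[of E _ _ _ t]) auto
  qed
  moreover have "linked ?E ({..<Suc n} - Y)" if Y: "Y \<in># F - {#X#} + stack_faces n X" for Y
  proof (cases "Y \<in># F - {#X#}")
    case True
    then have YF: "Y \<in># F" by (rule in_diffD)
    have "Y \<noteq> X" using True ordered_stacking_face_unique[OF step.hyps] by blast
    moreover have "card Y = 3" "Y \<subseteq> {..<n}" using ordered_stacking_face[OF step.hyps(1) YF] by auto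
    ultimately have "\<not> X \<subseteq> Y" using X by (metis card_subset_eq finite_lessThan finite_subset)
    then obtain t where t: "t \<in> X" "t \<notin> Y" by blast
    have eq: "{..<Suc n} - Y = insert n ({..<n} - Y)" using \<open>Y \<subseteq> {..<n}\<close> by (auto simp: less_Suc_eq)
    show ?thesis unfolding eq using step.IH YF X edge t by (intro linked_insert[of E _ _ _ t]) auto
  next
    case False
    with Y have "Y = {n, a, b} \<or> Y = {n, b, c} \<or> Y = {n, a, c}"
      using abc by (simp add: stack_faces_triangle)
    then obtain u w where uw: "Y = {n, u, w}" "u < n" "w < n" using abc by metis
    then have eq: "{..<Suc n} - Y = {..<n} - {u, w}" by (auto simp: less_Suc_eq)
    have "linked E ({..<n} - {u, w})"
      by (rule conjunct1[OF step.IH, rule_format]) (simp add: card_insert_if)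
    then show ?thesis unfolding eq by (rule linked_mono) simp
  qed
  ultimately show ?case by blast
qed

text \<open>The vertices off \<open>X\<close> induce a connected graph whose edges do not cross the
  boundary of the triangle, so all of them are on one side of it. The existential form names this
  side without choosing a vertex.\<close>

lemma ordered_stacking_side:
  assumes os: "ordered_stacking n E F" and emb: "plane_straight_line_embedding {..<n} E \<phi>"
    and "X \<in># F" "d < n" "d \<notin> X"
  shows "(\<exists>d\<in>{..<n} - X. \<phi> d \<in> convex hull (\<phi> ` X)) \<longleftrightarrow> \<phi> d \<in> convex hull (\<phi> ` X)"
proof -
  have "\<phi> u \<in> convex hull (\<phi> ` X) \<longleftrightarrow> \<phi> w \<in> convex hull (\<phi> ` X)"
    if "u \<in> {..<n} - X" "w \<in> {..<n} - X" for u w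
  proof (rule linkedD[of E "{..<n} - X" "\<lambda>u. \<phi> u \<in> convex hull (\<phi> ` X)"])
    show "linked E ({..<n} - X)" using ordered_stacking_linked[OF os] assms(3) by blast
    show "\<phi> u \<in> convex hull (\<phi> ` X) \<longleftrightarrow> \<phi> w \<in> convex hull (\<phi> ` X)"
      if "u \<in> {..<n} - X" "w \<in> {..<n} - X" "{u, w} \<in> E" for u w
      using that ordered_stacking_face(2,3)[OF os assms(3)] by (intro embedding_edge_side[OF emb]) auto
  qed (use that in auto)
  with assms show ?thesis by blast
qed

text \<open>Some \<open>t \<in> X\<close> is not in \<open>Y\<close>, and the edge from
  \<open>n\<close> to \<open>t\<close> is disjoint from the triangle on \<open>Y\<close>, so both
  ends are on the same side of it.\<close>

lemma ordered_stacking_new_vertex_side: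
  assumes os: "ordered_stacking n E F" and X: "X \<in># F"
    and emb: "plane_straight_line_embedding {..<Suc n} (E \<union> stack_edges n X) \<phi>"
    and Y: "Y \<in># F" "Y \<noteq> X"
  shows "\<phi> n \<in> convex hull (\<phi> ` Y) \<longleftrightarrow> (\<exists>d\<in>{..<n} - Y. \<phi> d \<in> convex hull (\<phi> ` Y))"
proof -
  note faceX = ordered_stacking_face[OF os X] and faceY = ordered_stacking_face[OF os Y(1)]
  have "\<not> X \<subseteq> Y" using Y faceX faceY by (metis card_subset_eq finite_lessThan finite_subset)
  then obtain t where t: "t \<in> X" "t \<notin> Y" by blast
  have "\<phi> n \<in> convex hull (\<phi> ` Y) \<longleftrightarrow> \<phi> t \<in> convex hull (\<phi> ` Y)"
    using faceY t by (intro embedding_edge_side[OF emb]) (auto simp: stack_edges_def)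
  also have "\<dots> \<longleftrightarrow> (\<exists>d\<in>{..<n} - Y. \<phi> d \<in> convex hull (\<phi> ` Y))"
    using ordered_stacking_side[OF os embedding_mono[OF emb] Y(1), of t] t faceX by auto
  finally show ?thesis .
qed

text \<open>By \<open>four_triangles_parity\<close>, exchanging a triangle for the three triangles
  at a new vertex changes the count by an even number.\<close>

lemma ordered_stacking_point_parity:
  fixes \<phi> :: "nat \<Rightarrow> real ^ 2"
  assumes "ordered_stacking n E F" "\<And>u w. {u, w} \<in> E \<Longrightarrow> p \<notin> closed_segment (\<phi> u) (\<phi> w)"
  shows "even (size (filter_mset (\<lambda>X. p \<in> convex hull (\<phi> ` X)) F))"
  using assms
proof (induction rule: ordered_stacking.induct)
  case base
  have "p \<in> convex hull {\<phi> 0, \<phi> 1, \<phi> 2} \<longleftrightarrow>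
      (p \<in> convex hull {\<phi> 3, \<phi> 0, \<phi> 1} \<longleftrightarrow> (p \<in> convex hull {\<phi> 3, \<phi> 1, \<phi> 2} \<longleftrightarrow> p \<in> convex hull {\<phi> 3, \<phi> 0, \<phi> 2}))"
    by (intro four_triangles_parity base) (simp_all add: stack_edges_triangle)
  then show ?case by (simp add: stack_faces_triangle)
next
  case (step n E F X)
  obtain a b c where abc: "X = {a, b, c}" "a \<noteq> b" "b \<noteq> c" "a \<noteq> c"
    "{a, b} \<in> E" "{b, c} \<in> E" "{a, c} \<in> E"
    using ordered_stacking_face_obtain[OF step.hyps] by metis
  have "p \<in> convex hull {\<phi> a, \<phi> b, \<phi> c} \<longleftrightarrow>
      (p \<in> convex hull {\<phi> n, \<phi> a, \<phi> b} \<longleftrightarrow> (p \<in> convex hull {\<phi> n, \<phi> b, \<phi> c} \<longleftrightarrow> p \<in> convex hull {\<phi> n, \<phi> a, \<phi> c}))"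
    using abc by (intro four_triangles_parity step.prems) (simp_all add: stack_edges_triangle)
  moreover have "even (size (filter_mset (\<lambda>X. p \<in> convex hull (\<phi> ` X)) F))"
    by (rule step.IH) (simp add: step.prems)
  moreover obtain F0 where "F = add_mset X F0" using step.hyps(2) by (metis mset_add)
  ultimately show ?case using abc(2-4) unfolding abc(1)
    by (simp add: stack_faces_triangle split: if_splits)
qed

lemma size_filter_mset_cong:
  assumes "\<And>X. X \<in># F \<Longrightarrow> P X = Q X"
  shows "size (filter_mset P F) = size (filter_mset Q F)"
  using assms by (simp cong: filter_mset_cong)

text \<open>In a plane drawing exactly one face, the outer one, has the remaining vertices in its
  convex hull; the parity of the number of such faces is all that is needed.\<close>

lemma ordered_stacking_outer_parity:
  assumes "ordered_stacking n E F" "plane_straight_line_embedding {..<n} E \<phi>"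
  shows "odd (size (filter_mset (\<lambda>X. \<exists>d\<in>{..<n} - X. \<phi> d \<in> convex hull (\<phi> ` X)) F))"
  using assms
proof (induction rule: ordered_stacking.induct)
  case base
  have "\<phi> 3 \<in> convex hull (\<phi> ` {0, 1, 2}) \<longleftrightarrow>
    \<not> (\<phi> 2 \<in> convex hull (\<phi> ` {3, 0, 1}) \<longleftrightarrow>
      (\<phi> 0 \<in> convex hull (\<phi> ` {3, 1, 2}) \<longleftrightarrow> \<phi> 1 \<in> convex hull (\<phi> ` {3, 0, 2})))"
    by (rule embedding_K4_parity[OF base]) (auto simp: stack_edges_triangle)
  moreover have "{..<4} - {0, 1, 2} = {3::nat}" "{..<4} - {3, 0, 1} = {2::nat}"
    "{..<4} - {3, 1, 2} = {0::nat}" "{..<4} - {3, 0, 2} = {1::nat}"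
    by (auto simp: lessThan_4)
  ultimately show ?case by (auto simp: stack_faces_triangle)
next
  case (step n E F X)
  let ?E = "E \<union> stack_edges n X"
  \<comment> \<open>\<open>s n X\<close> says that the vertices below \<open>n\<close> that are not
    on \<open>X\<close> lie in the triangle of \<open>X\<close>, that is, that \<open>X\<close>
    looks like the outer face.\<close>
  define In where "In = (\<lambda>v X. \<phi> v \<in> convex hull (\<phi> ` X))"
  define s where "s = (\<lambda>n X. \<exists>d\<in>{..<n::nat} - X. In d X)"
  note os = step.hyps(1)
  have emb: "plane_straight_line_embedding {..<n} E \<phi>"
    by (rule embedding_mono[OF step.prems]) auto
  obtain a b c where abc: "X = {a, b, c}" "a \<noteq> b" "b \<noteq> c" "a \<noteq> c" "a < n" "b < n" "c < n"
    "{a, b} \<in> E" "{b, c} \<in> E" "{a, c} \<in> E"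
    using ordered_stacking_face_obtain[OF step.hyps] by metis
  obtain F0 where F: "F = add_mset X F0" using step.hyps(2) by (metis mset_add)
  have X0: "X \<notin># F0" using ordered_stacking_face_unique[OF step.hyps] F by simp
  have new: "In n Y = s n Y" if "Y \<in># F0" for Y
    using ordered_stacking_new_vertex_side[OF step.hyps step.prems, of Y] that X0 F
    unfolding s_def In_def by fastforce
  have s_Suc: "s (Suc n) Y = s n Y" if "Y \<in># F0" for Y
  proof -
    have "n \<notin> Y" using that F ordered_stacking_face(1)[OF os, of Y] by auto
    then have "{..<Suc n} - Y = insert n ({..<n} - Y)" by (auto simp: less_Suc_eq)
    then have "s (Suc n) Y \<longleftrightarrow> In n Y \<or> s n Y" unfolding s_def by auto
    then show ?thesis using new[OF that] by blast
  qed
  \<comment> \<open>The counts for \<open>In n\<close> and \<open>s n\<close> over \<open>F\<close>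
    have different parities, yet the two predicates agree on every face other than \<open>X\<close>.
    They must therefore disagree on \<open>X\<close>.\<close>
  have "even (size (filter_mset (In n) F))"
    unfolding In_def
    using embedding_vertex_off_edge[OF step.prems, of _ _ n] ordered_stacking_edge_subset[OF os]
    by (intro ordered_stacking_point_parity[OF os]) fastforce
  moreover have "odd (size (filter_mset (s n) F))"
    using step.IH[OF emb] unfolding s_def In_def .
  moreover have "size (filter_mset (In n) F0) = size (filter_mset (s n) F0)"
    using new by (intro size_filter_mset_cong)
  ultimately have inX: "In n X \<longleftrightarrow> \<not> s n X" unfolding F by (auto split: if_splits)
  have os': "ordered_stacking (Suc n) ?E (F - {#X#} + stack_faces n X)"
    using step.hyps by (rule ordered_stacking.step)
  have side: "s (Suc n) Y = In d Y" if "Y \<in># stack_faces n X" "d < Suc n" "d \<notin> Y" for Y d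
    unfolding s_def In_def using that by (intro ordered_stacking_side[OF os' step.prems]) auto
  have "s (Suc n) {n, a, b} = In c {n, a, b}" "s (Suc n) {n, b, c} = In a {n, b, c}"
    "s (Suc n) {n, a, c} = In b {n, a, c}"
    by (rule side; use abc in \<open>simp add: stack_faces_triangle\<close>)+
  moreover have "In n {a, b, c} \<longleftrightarrow> \<not> (In c {n, a, b} \<longleftrightarrow> (In a {n, b, c} \<longleftrightarrow> In b {n, a, c}))"
    unfolding In_def
    using abc by (intro embedding_K4_parity[OF step.prems]) (auto simp: stack_edges_triangle)
  \<comment> \<open>The side of each new face is read off from the vertex of \<open>X\<close> it
    omits. By the parity for the complete graph on \<open>a\<close>, \<open>b\<close>,
    \<open>c\<close>, \<open>n\<close>, the value at \<open>X\<close> is the exclusive or of the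
    values at the three new faces, so the count stays odd.\<close>
  ultimately have "s n X \<longleftrightarrow> (s (Suc n) {n, a, b} \<longleftrightarrow> (s (Suc n) {n, b, c} \<longleftrightarrow> s (Suc n) {n, a, c}))"
    using inX abc(1) by blast
  moreover have "size (filter_mset (s (Suc n)) F0) = size (filter_mset (s n) F0)"
    using s_Suc by (intro size_filter_mset_cong)
  moreover have "odd (size (filter_mset (s n) F))"
    using step.IH[OF emb] unfolding s_def In_def .
  ultimately have "odd (size (filter_mset (s (Suc n)) (F - {#X#} + stack_faces n X)))"
    using abc unfolding F by (auto simp: stack_faces_triangle split: if_splits)
  then show ?case unfolding s_def In_def .
qed

text \<open>If \<open>X\<close> and \<open>X'\<close> differ, then every face differs from one of
  them, so \<open>ordered_stacking_new_vertex_side\<close> applies to all faces. The even number of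
  triangles around the new point would then equal the odd number of faces that look like the outer
  one.\<close>

lemma ordered_stacking_face_determined:
  assumes os: "ordered_stacking n E F" and X: "X \<in># F" "X' \<in># F"
    and emb: "plane_straight_line_embedding {..<Suc n} (E \<union> stack_edges n X) \<phi>"
    and emb': "plane_straight_line_embedding {..<Suc n} (E \<union> stack_edges n X') \<phi>"
  shows "X = X'"
proof (rule ccontr)
  assume ne: "X \<noteq> X'"
  have "even (size (filter_mset (\<lambda>Y. \<phi> n \<in> convex hull (\<phi> ` Y)) F))"
    using embedding_vertex_off_edge[OF emb, of _ _ n] ordered_stacking_edge_subset[OF os]
    by (intro ordered_stacking_point_parity[OF os]) fastforce
  moreover have "odd (size (filter_mset (\<lambda>Y. \<exists>d\<in>{..<n} - Y. \<phi> d \<in> convex hull (\<phi> ` Y)) F))"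
    by (intro ordered_stacking_outer_parity[OF os] embedding_mono[OF emb]) auto
  moreover have "\<phi> n \<in> convex hull (\<phi> ` Y) \<longleftrightarrow> (\<exists>d\<in>{..<n} - Y. \<phi> d \<in> convex hull (\<phi> ` Y))"
    if "Y \<in># F" for Y
    using ordered_stacking_new_vertex_side[OF os X(1) emb that]
      ordered_stacking_new_vertex_side[OF os X(2) emb' that] ne by blast
  ultimately show False
    using size_filter_mset_cong[of F "\<lambda>Y. \<phi> n \<in> convex hull (\<phi> ` Y)"
        "\<lambda>Y. \<exists>d\<in>{..<n} - Y. \<phi> d \<in> convex hull (\<phi> ` Y)"] by auto
qed

lemma ordered_stacking_Suc_cases:
  assumes "ordered_stacking (Suc n) E F" "4 \<le> n"
  obtains E0 F0 X where "ordered_stacking n E0 F0" "X \<in># F0" "E = E0 \<union> stack_edges n X"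
    "F = F0 - {#X#} + stack_faces n X"
  using assms(1)
proof cases
  case base
  with assms(2) show thesis by simp
qed (use that in blast)

lemma ordered_stacking_4_cases:
  assumes "ordered_stacking 4 E F"
  shows "E = {{0, 1}, {1, 2}, {0, 2}} \<union> stack_edges 3 {0, 1, 2}"
    "F = {#{0, 1, 2}#} + stack_faces 3 {0, 1, 2}"
  using assms by (cases; use ordered_stacking_ge_4 in fastforce)+

text \<open>Dropping the last vertex leaves embeddings of the two previous graphs, which agree by
  induction. The face used last is then determined as well.\<close>

lemma ordered_stacking_determined:
  assumes "ordered_stacking n E F" "ordered_stacking n E' F'"
    "plane_straight_line_embedding {..<n} E \<phi>" "plane_straight_line_embedding {..<n} E' \<phi>"
  shows "E = E' \<and> F = F'"
  using assms
proof (induction arbitrary: E' F' rule: ordered_stacking.induct)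
  case base
  then show ?case using ordered_stacking_4_cases by metis
next
  case (step n E F X)
  obtain E0 F0 X' where os: "ordered_stacking n E0 F0" "X' \<in># F0" "E' = E0 \<union> stack_edges n X'"
    "F' = F0 - {#X'#} + stack_faces n X'"
    using ordered_stacking_Suc_cases[OF step.prems(1) ordered_stacking_ge_4[OF step.hyps(1)]] .
  have emb: "plane_straight_line_embedding {..<n} E \<phi>" "plane_straight_line_embedding {..<n} E0 \<phi>"
    using embedding_mono[OF step.prems(2), of "{..<n}" E] embedding_mono[OF step.prems(3), of "{..<n}" E0]
      os(3) by auto
  have eq: "E = E0" "F = F0" using step.IH[OF os(1) emb] by auto
  moreover have "X = X'"
    using ordered_stacking_face_determined[OF step.hyps _ step.prems(2)] os(2) step.prems(3)
    unfolding os(3) eq by blast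
  ultimately show ?case using os by simp
qed

section \<open>Counting ordered stackings\<close>

definition stackings :: "nat \<Rightarrow> (nat set set \<times> nat set multiset) set" where
  "stackings n = {(E, F). ordered_stacking n E F}"

definition stack_step :: "nat \<Rightarrow> (nat set set \<times> nat set multiset) \<times> nat set \<Rightarrow> nat set set \<times> nat set multiset" where
  "stack_step n = (\<lambda>((E, F), X). (E \<union> stack_edges n X, F - {#X#} + stack_faces n X))"

lemma card_stackings_4: "card (stackings 4) = 1"
proof -
  have "stackings 4 = {({{0, 1}, {1, 2}, {0, 2}} \<union> stack_edges 3 {0, 1, 2},
    {#{0, 1, 2}#} + stack_faces 3 {0, 1, 2})}"
    unfolding stackings_def using ordered_stacking_4_cases ordered_stacking.base by blast
  then show ?thesis by simp
qed

lemma stackings_Suc: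
  assumes "4 \<le> n"
  shows "stackings (Suc n) = stack_step n ` (SIGMA g:stackings n. set_mset (snd g))"
proof (intro equalityI subsetI)
  fix g assume "g \<in> stackings (Suc n)"
  then obtain E F where g: "g = (E, F)" "ordered_stacking (Suc n) E F"
    unfolding stackings_def by blast
  then obtain E0 F0 X where *: "ordered_stacking n E0 F0" "X \<in># F0" "E = E0 \<union> stack_edges n X"
    "F = F0 - {#X#} + stack_faces n X"
    using ordered_stacking_Suc_cases assms by metis
  then have "g = stack_step n ((E0, F0), X)" by (simp add: g stack_step_def)
  with * show "g \<in> stack_step n ` (SIGMA g:stackings n. set_mset (snd g))"
    by (intro image_eqI[of _ _ "((E0, F0), X)"]) (auto simp: stackings_def)
next
  fix g assume "g \<in> stack_step n ` (SIGMA g:stackings n. set_mset (snd g))"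
  then show "g \<in> stackings (Suc n)"
    by (auto simp: stackings_def stack_step_def intro: ordered_stacking.step)
qed

text \<open>A step can be undone: \<open>X\<close> is the neighbourhood of \<open>n\<close>,
  \<open>E\<close> consists of the edges avoiding \<open>n\<close>, and \<open>F\<close> results
  from reversing the replacement of \<open>X\<close>.\<close>

lemma inj_on_stack_step: "inj_on (stack_step n) (SIGMA g:stackings n. set_mset (snd g))"
proof (rule inj_onI)
  fix g h assume g: "g \<in> (SIGMA g:stackings n. set_mset (snd g))"
    and h: "h \<in> (SIGMA g:stackings n. set_mset (snd g))" and eq: "stack_step n g = stack_step n h"
  obtain E F X where gE: "g = ((E, F), X)" "ordered_stacking n E F" "X \<in># F"
    using g by (auto simp: stackings_def)
  obtain E' F' X' where hE: "h = ((E', F'), X')" "ordered_stacking n E' F'" "X' \<in># F'"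
    using h by (auto simp: stackings_def)
  have eqE: "E \<union> stack_edges n X = E' \<union> stack_edges n X'"
    and eqF: "F - {#X#} + stack_faces n X = F' - {#X'#} + stack_faces n X'"
    using eq by (auto simp: gE hE stack_step_def)
  have old: "{e \<in> E \<union> stack_edges n X. n \<notin> e} = E" if "ordered_stacking n E F" for E F X
    using ordered_stacking_edge_subset[OF that] by (auto simp: stack_edges_def)
  have new: "{a. {n, a} \<in> E \<union> stack_edges n X} = X" if "ordered_stacking n E F" for E F X
    using ordered_stacking_edge_subset[OF that, of "{n, _}"] by (auto simp: stack_edges_def doubleton_eq_iff)
  have "E = E'" using old[OF gE(2), of X] old[OF hE(2), of X'] eqE by simp
  moreover have X: "X = X'" using new[OF gE(2), of X] new[OF hE(2), of X'] eqE by simp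
  moreover have "F = F'"
    using eqF gE(3) hE(3) unfolding X by (metis add_right_cancel insert_DiffM)
  ultimately show "g = h" by (simp add: gE hE)
qed

lemma ordered_stacking_card_faces:
  assumes "ordered_stacking n E F"
  shows "card (set_mset F) = 2 * n - 4"
proof -
  have "count F X = 1" if "X \<in># F" for X
    using that ordered_stacking_count[OF assms, of X] by (metis count_greater_eq_one_iff le_antisym)
  then have "size F = card (set_mset F)" by (simp add: size_multiset_overloaded_eq)
  with stacked_with_faces_size[OF ordered_stacking_stacked_with_faces[OF assms]] show ?thesis by simp
qed

text \<open>The number is the product of the face counts \<open>2 * k - 4 = 2 * (k - 2)\<close> for
  \<open>k\<close> from 4 to \<open>n - 1\<close>.\<close>

lemma card_stackings:
  assumes "4 \<le> n"
  shows "finite (stackings n) \<and> card (stackings n) = 2 ^ (n - 4) * fact (n - 3)"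
  using assms
proof (induction n rule: nat_induct_at_least)
  case base
  have "finite (stackings 4)" using card_stackings_4 by (intro card_ge_0_finite) simp
  then show ?case using card_stackings_4 by simp
next
  case (Suc n)
  have fin: "\<forall>g\<in>stackings n. finite (set_mset (snd g))" by simp
  have "card (stackings (Suc n)) = (\<Sum>g\<in>stackings n. card (set_mset (snd g)))"
    unfolding stackings_Suc[OF Suc.hyps] card_image[OF inj_on_stack_step]
    using Suc.IH fin by (intro card_SigmaI) auto
  also have "\<dots> = (\<Sum>g\<in>stackings n. 2 * n - 4)"
    by (intro sum.cong) (auto simp: stackings_def ordered_stacking_card_faces)
  also have "\<dots> = 2 ^ (n - 4) * fact (n - 3) * (2 * n - 4)" using Suc.IH by simp
  also have "\<dots> = 2 ^ (Suc n - 4) * fact (Suc n - 3)"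
  proof -
    obtain k where k: "n = k + 4" using Suc.hyps by (metis add.commute le_iff_add)
    show ?thesis by (simp add: k algebra_simps)
  qed
  finally have "card (stackings (Suc n)) = 2 ^ (Suc n - 4) * fact (Suc n - 3)" .
  moreover have "finite (stackings (Suc n))"
    unfolding stackings_Suc[OF Suc.hyps] using Suc.IH by auto
  ultimately show ?case by blast
qed

lemma ordered_stacking_in_stacked_triangulations:
  assumes "ordered_stacking n E F"
  shows "({..<n}, E) \<in> stacked_triangulations n"
  using ordered_stacking_stacked_with_faces[OF assms] unfolding stacked_triangulations_def by auto

text \<open>The falling factorial, which counts injections. For \<open>m < n\<close> both sides are
  0, the left one because a factor \<open>m - m\<close> occurs.\<close>

lemma prod_diff_eq_fact_binomial: "(\<Prod>i = 0..<n. m - i) = fact n * (m choose n)" for m n :: nat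
proof (induction n)
  case (Suc n)
  have "(m - n) * (m choose n) = Suc n * (m choose Suc n)"
    by (simp only: binomial_absorb_comp binomial_absorption)
  then have "fact n * ((m - n) * (m choose n)) = fact (Suc n) * (m choose Suc n)"
    by (simp only: fact_Suc of_nat_id mult_ac)
  moreover have "(\<Prod>i = 0..<Suc n. m - i) = fact n * ((m - n) * (m choose n))"
    by (simp only: prod.atLeast0_lessThan_Suc Suc mult_ac)
  ultimately show ?case by simp
qed simp

text \<open>A chosen drawing on \<open>S\<close> encodes each stacking as an injection of the labels
  into \<open>S\<close>. The code is injective by \<open>ordered_stacking_determined\<close>, so it
  remains to count injections.\<close>

lemma universal_card_bound:
  assumes univ: "universal_for S (stacked_triangulations n)" and "4 \<le> n"
  shows "2 ^ (n - 4) * fact (n - 3) \<le> fact n * (card S choose n)"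
proof -
  have fin: "finite S" using univ unfolding universal_for_def by blast
  have "\<exists>\<phi>. plane_straight_line_embedding {..<n} E \<phi> \<and> \<phi> ` {..<n} \<subseteq> S"
    if "ordered_stacking n E F" for E F
    using ordered_stacking_in_stacked_triangulations[OF that] univ unfolding universal_for_def by blast
  then obtain \<Phi> where \<Phi>: "\<And>E F. ordered_stacking n E F \<Longrightarrow>
      plane_straight_line_embedding {..<n} E (\<Phi> E) \<and> \<Phi> E ` {..<n} \<subseteq> S"
    by metis
  \<comment> \<open>Restriction fixes the values outside the labels, so that the drawings lie in a
    finite function space.\<close>
  define \<Psi> where "\<Psi> = (\<lambda>g :: nat set set \<times> nat set multiset. restrict (\<Phi> (fst g)) {..<n})"
  have emb: "plane_straight_line_embedding {..<n} E (\<Psi> (E, F))" if "ordered_stacking n E F" for E F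
    using \<Phi>[OF that] ordered_stacking_edge_subset[OF that]
    by (intro embedding_cong[of "{..<n}" "\<Phi> E" "\<Psi> (E, F)" E]) (auto simp: \<Psi>_def)
  let ?I = "{f \<in> {..<n} \<rightarrow>\<^sub>E S. inj_on f {..<n}}"
  have "\<Psi> ` stackings n \<subseteq> ?I"
  proof
    fix f assume "f \<in> \<Psi> ` stackings n"
    then obtain E F where f: "f = \<Psi> (E, F)" and os: "ordered_stacking n E F"
      by (auto simp: stackings_def)
    have "inj_on f {..<n}"
      using emb[OF os] unfolding f plane_straight_line_embedding_def by blast
    moreover have "f \<in> {..<n} \<rightarrow>\<^sub>E S" using \<Phi>[OF os] by (auto simp: f \<Psi>_def)
    ultimately show "f \<in> ?I" by blast
  qed
  moreover have "inj_on \<Psi> (stackings n)"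
  proof (rule inj_onI)
    fix g h assume "g \<in> stackings n" "h \<in> stackings n" and eq: "\<Psi> g = \<Psi> h"
    then obtain E F E' F' where gh: "g = (E, F)" "h = (E', F')" "ordered_stacking n E F" "ordered_stacking n E' F'"
      by (auto simp: stackings_def)
    show "g = h"
      using ordered_stacking_determined[OF gh(3,4) emb[OF gh(3)]] emb[OF gh(4)] eq gh by simp
  qed
  moreover have "finite ?I"
    by (rule finite_subset[of _ "{..<n} \<rightarrow>\<^sub>E S"]) (use fin in \<open>auto intro!: finite_PiE\<close>)
  ultimately have "card (stackings n) \<le> card ?I" by (intro card_inj_on_le[of \<Psi>])
  also have "card ?I = (\<Prod>i = 0..<n. card S - i)"
    using card_inj_on_subset_funcset[of "{..<n}" S "{..<n}"] fin by simp
  also have "\<dots> = fact n * (card S choose n)" by (rule prod_diff_eq_fact_binomial)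
  finally show ?thesis unfolding conjunct2[OF card_stackings[OF \<open>4 \<le> n\<close>]] .
qed

text \<open>The factor 16 makes up for \<open>2 ^ (n - 4)\<close> in place of \<open>2 ^ n\<close>,
  and \<open>n ^ 3\<close> bounds the quotient of the factorials.\<close>

lemma universal_card_bound_real:
  assumes univ: "universal_for S (stacked_triangulations n)" and "4 \<le> n"
  shows "2 ^ n \<le> 16 * real n ^ 3 * real (card S choose n)"
proof -
  obtain k where k: "n = k + 4" using \<open>4 \<le> n\<close> by (metis add.commute le_iff_add)
  have n: "(2::nat) ^ n = 16 * 2 ^ (n - 4)" by (simp add: k power_add)
  have "fact n = n * (n - 1) * (n - 2) * (fact (n - 3) :: nat)"
    using fact_reduce[of n, where 'a = nat] fact_reduce[of "n - 1", where 'a = nat]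
      fact_reduce[of "n - 2", where 'a = nat] \<open>4 \<le> n\<close> by (simp add: numeral_eq_Suc)
  also have "\<dots> \<le> n * n * n * fact (n - 3)" by (intro mult_le_mono) auto
  finally have f: "(fact n :: nat) \<le> n ^ 3 * fact (n - 3)" by (simp add: power3_eq_cube)
  have "2 ^ (n - 4) * fact (n - 3) \<le> n ^ 3 * fact (n - 3) * (card S choose n)"
    using universal_card_bound[OF assms] mult_le_mono1[OF f, of "card S choose n"] by linarith
  then have "fact (n - 3) * 2 ^ (n - 4) \<le> fact (n - 3) * (n ^ 3 * (card S choose n))"
    by (simp add: mult_ac)
  then have "2 ^ (n - 4) \<le> n ^ 3 * (card S choose n)" by (metis fact_nonzero mult_le_cancel1 neq0_conv)
  then have "2 ^ n \<le> 16 * n ^ 3 * (card S choose n)" unfolding n by simp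
  then have "real (2 ^ n) \<le> real (16 * n ^ 3 * (card S choose n))" by (rule of_nat_mono)
  then show ?thesis by simp
qed

section \<open>Existence of universal point sets\<close>

text \<open>The coordinates are not normalised, which makes the expression linear in them.
  Uniqueness is recovered in \<open>barycentric_inj\<close> by comparing triples with the same
  sum.\<close>

definition barycentric :: "'a::real_vector \<Rightarrow> 'a \<Rightarrow> 'a \<Rightarrow> real \<Rightarrow> real \<Rightarrow> real \<Rightarrow> 'a" where
  "barycentric A B C x y z = x *\<^sub>R A + y *\<^sub>R B + z *\<^sub>R C"

lemma barycentric_vertices:
  "A = barycentric A B C 1 0 0" "B = barycentric A B C 0 1 0" "C = barycentric A B C 0 0 1"
  by (simp_all add: barycentric_def)

lemma barycentric_arith:
  "barycentric A B C x y z + barycentric A B C x' y' z' = barycentric A B C (x + x') (y + y') (z + z')"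
  "barycentric A B C x y z - barycentric A B C x' y' z' = barycentric A B C (x - x') (y - y') (z - z')"
  "u *\<^sub>R barycentric A B C x y z = barycentric A B C (u * x) (u * y) (u * z)"
  by (simp_all add: barycentric_def algebra_simps)

text \<open>Equal sums eliminate the third coordinate and leave a linear relation between
  \<open>A - C\<close> and \<open>B - C\<close>, which are independent.\<close>

lemma barycentric_inj:
  fixes A B C :: "real ^ 2"
  assumes nc: "\<not> collinear {A, B, C}" and eq: "barycentric A B C x y z = barycentric A B C x' y' z'"
    and sum: "x + y + z = x' + y' + z'"
  shows "x = x' \<and> y = y' \<and> z = z'"
proof -
  define u v where "u = x - x'" "v = y - y'"
  have nc': "\<not> collinear {0, A - C, B - C}"
    using nc collinear_3[of A C B] by (simp add: insert_commute)
  have z: "z - z' = - u - v" using sum by (simp add: u_v_def)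
  have "u *\<^sub>R A + v *\<^sub>R B + (z - z') *\<^sub>R C = 0"
    using eq by (simp add: barycentric_def u_v_def algebra_simps)
  then have eq: "u *\<^sub>R (A - C) + v *\<^sub>R (B - C) = 0"
    unfolding z by (simp add: algebra_simps)
  have "u = 0 \<and> v = 0"
  proof (rule ccontr)
    assume "\<not> (u = 0 \<and> v = 0)"
    then consider "u \<noteq> 0" | "v \<noteq> 0" by blast
    then show False
    proof cases
      case 1
      have "A - C = (1 / u) *\<^sub>R (u *\<^sub>R (A - C))" using 1 by simp
      also have "u *\<^sub>R (A - C) = - v *\<^sub>R (B - C)" using eq by (simp add: add_eq_0_iff2)
      finally have "A - C = (- v / u) *\<^sub>R (B - C)" by simp
      then have "collinear {0, B - C, A - C}" unfolding collinear_lemma by blast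
      then show False using nc' by (simp add: insert_commute)
    next
      case 2
      have "B - C = (1 / v) *\<^sub>R (v *\<^sub>R (B - C))" using 2 by simp
      also have "v *\<^sub>R (B - C) = - u *\<^sub>R (A - C)" using eq by (simp add: add_eq_0_iff)
      finally have "B - C = (- u / v) *\<^sub>R (A - C)" by simp
      then have "collinear {0, A - C, B - C}" unfolding collinear_lemma by blast
      then show False using nc' by simp
    qed
  qed
  with sum show ?thesis by (simp add: u_v_def)
qed

text \<open>For insertion into a bounded face: the spokes from the centroid \<open>g\<close> cut the
  triangle into three. Only the part at the side \<open>A B\<close> is treated, the others follow by
  permuting the vertices.\<close>

lemma centroid_separates:
  fixes A B C :: "real ^ 2"
  assumes nc: "\<not> collinear {A, B, C}"
  defines "g \<equiv> (1 / 3) *\<^sub>R (A + B + C)"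
  shows "\<not> collinear {g, A, B}" "interior (convex hull {g, A, B}) \<inter> closed_segment g C = {}"
    "g \<in> interior (convex hull {A, B, C})"
proof -
  define P where "P = barycentric A B C"
  note P = barycentric_vertices[where A = A and B = B and C = C, folded P_def]
    and P_add = barycentric_arith(1)[of A B C, folded P_def]
    and P_diff = barycentric_arith(2)[of A B C, folded P_def]
    and P_scale = barycentric_arith(3)[of _ A B C, folded P_def]
    and P_inj = barycentric_inj[OF nc, folded P_def]
  have g: "g = P (1 / 3) (1 / 3) (1 / 3)" unfolding g_def P by (simp add: P_add P_scale)
  note seg = closed_segment_def P g P_add P_scale
  show ncg: "\<not> collinear {g, A, B}"
    by (rule not_collinear_if_not_between; auto simp: seg dest!: P_inj; simp add: field_simps)
  show "interior (convex hull {g, A, B}) \<inter> closed_segment g C = {}"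
  proof (rule equals0I)
    fix p assume p: "p \<in> interior (convex hull {g, A, B}) \<inter> closed_segment g C"
    then obtain x y z where xyz: "0 < x" "0 < y" "0 < z" "x + y + z = 1" "p = x *\<^sub>R g + y *\<^sub>R A + z *\<^sub>R B"
      using interior_convex_hull_3_minimal[OF ncg] by auto
    from p obtain t where t: "0 \<le> t" "t \<le> 1" "p = (1 - t) *\<^sub>R g + t *\<^sub>R C"
      by (auto simp: closed_segment_def)
    have eq: "P (x / 3 + y) (x / 3 + z) (x / 3) = P ((1 - t) / 3) ((1 - t) / 3) ((1 - t) / 3 + t)"
      using xyz(5) t(3) by (simp add: P g P_add P_scale)
    have "(x / 3 + y) + (x / 3 + z) + x / 3 = (1 - t) / 3 + (1 - t) / 3 + ((1 - t) / 3 + t)"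
      using xyz(4) by (simp add: field_simps)
    from P_inj[OF eq this] xyz t show False by (simp add: field_simps)
  qed
  show "g \<in> interior (convex hull {A, B, C})"
    using interior_convex_hull_3_minimal[OF nc]
    by (auto simp: g_def algebra_simps intro!: exI[of _ "1 / 3"])
qed

text \<open>For insertion into the outer face: \<open>h\<close> is the point beyond \<open>C\<close>
  that makes \<open>C\<close> the centroid of \<open>h\<close>, \<open>A\<close>, \<open>B\<close>.
  The triangle \<open>h A B\<close> thus encloses the old one, and the segments from
  \<open>h\<close> reach the old triangle only at its vertices.\<close>

lemma reflected_point_separates:
  fixes A B C :: "real ^ 2"
  assumes nc: "\<not> collinear {A, B, C}"
  defines "h \<equiv> 3 *\<^sub>R C - A - B"
  shows "\<not> collinear {h, A, B}" "\<not> collinear {h, B, C}"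
    "interior (convex hull {h, B, C}) \<inter> convex hull {A, B, C} = {}"
    "interior (convex hull {h, B, C}) \<inter> closed_segment h A = {}"
    "closed_segment h A \<inter> convex hull {A, B, C} \<subseteq> {A}"
    "closed_segment h C \<inter> convex hull {A, B, C} \<subseteq> {C}"
    "C \<in> convex hull {h, A, B}" "h \<notin> convex hull {A, B, C}"
proof -
  define P where "P = barycentric A B C"
  note P = barycentric_vertices[where A = A and B = B and C = C, folded P_def]
    and P_add = barycentric_arith(1)[of A B C, folded P_def]
    and P_diff = barycentric_arith(2)[of A B C, folded P_def]
    and P_scale = barycentric_arith(3)[of _ A B C, folded P_def]
    and P_inj = barycentric_inj[OF nc, folded P_def]
  have h: "h = P (- 1) (- 1) 3" unfolding h_def P by (simp add: P_diff P_scale)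
  note seg = closed_segment_def P h P_add P_scale
  show "\<not> collinear {h, A, B}"
    by (rule not_collinear_if_not_between) (auto simp: seg dest!: P_inj)
  show nch: "\<not> collinear {h, B, C}"
    by (rule not_collinear_if_not_between) (auto simp: seg dest!: P_inj)
  have hull: "\<exists>x y z. 0 \<le> x \<and> 0 \<le> y \<and> 0 \<le> z \<and> x + y + z = 1 \<and> p = P x y z"
    if "p \<in> convex hull {A, B, C}" for p
    using that unfolding convex_hull_3 by (auto simp: P P_add P_scale)
  have int: "\<exists>x y z. 0 < x \<and> 0 < y \<and> 0 < z \<and> x + y + z = 1 \<and> p = P (- x) (y - x) (x * 3 + z)"
    if "p \<in> interior (convex hull {h, B, C})" for p
    using that interior_convex_hull_3_minimal[OF nch] by (auto simp: P h P_add P_scale)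
  have segA: "\<exists>t. 0 \<le> t \<and> t \<le> 1 \<and> p = P (2 * t - 1) (t - 1) (3 - 3 * t)"
    if "p \<in> closed_segment h A" for p
    using that unfolding closed_segment_def by (auto simp: P h P_add P_scale algebra_simps)
  have segC: "\<exists>t. 0 \<le> t \<and> t \<le> 1 \<and> p = P (t - 1) (t - 1) (3 - 2 * t)"
    if "p \<in> closed_segment h C" for p
    using that unfolding closed_segment_def by (auto simp: P h P_add P_scale algebra_simps)
  \<comment> \<open>The two sets are told apart by the sign of the coordinate at \<open>A\<close>.
    The claims below follow in the same way from the coordinate at \<open>B\<close>.\<close>
  show "interior (convex hull {h, B, C}) \<inter> convex hull {A, B, C} = {}"
  proof (rule equals0I)
    fix p assume "p \<in> interior (convex hull {h, B, C}) \<inter> convex hull {A, B, C}"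
    then obtain x y z x' y' z' where "0 < x" "x + y + z = 1" "p = P (- x) (y - x) (x * 3 + z)"
      "0 \<le> x'" "x' + y' + z' = 1" "p = P x' y' z'" using int[of p] hull[of p] by auto
    then show False using P_inj[of "- x" "y - x" "x * 3 + z" x' y' z'] by simp
  qed
  show "interior (convex hull {h, B, C}) \<inter> closed_segment h A = {}"
  proof (rule equals0I)
    fix p assume "p \<in> interior (convex hull {h, B, C}) \<inter> closed_segment h A"
    then obtain x y z t where "0 < x" "0 < y" "x + y + z = 1" "p = P (- x) (y - x) (x * 3 + z)"
      "0 \<le> t" "p = P (2 * t - 1) (t - 1) (3 - 3 * t)" using int[of p] segA[of p] by auto
    then show False using P_inj[of "- x" "y - x" "x * 3 + z" "2 * t - 1" "t - 1" "3 - 3 * t"] by simp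
  qed
  show "closed_segment h A \<inter> convex hull {A, B, C} \<subseteq> {A}"
  proof
    fix p assume "p \<in> closed_segment h A \<inter> convex hull {A, B, C}"
    then obtain t x' y' z' where *: "t \<le> 1" "p = P (2 * t - 1) (t - 1) (3 - 3 * t)"
      "0 \<le> y'" "x' + y' + z' = 1" "p = P x' y' z'" using segA[of p] hull[of p] by auto
    then have "t = 1" using P_inj[of "2 * t - 1" "t - 1" "3 - 3 * t" x' y' z'] by simp
    with * show "p \<in> {A}" by (simp add: P)
  qed
  show "closed_segment h C \<inter> convex hull {A, B, C} \<subseteq> {C}"
  proof
    fix p assume "p \<in> closed_segment h C \<inter> convex hull {A, B, C}"
    then obtain t x' y' z' where *: "t \<le> 1" "p = P (t - 1) (t - 1) (3 - 2 * t)"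
      "0 \<le> y'" "x' + y' + z' = 1" "p = P x' y' z'" using segC[of p] hull[of p] by auto
    then have "t = 1" using P_inj[of "t - 1" "t - 1" "3 - 2 * t" x' y' z'] by simp
    with * show "p \<in> {C}" by (simp add: P)
  qed
  have "C = (1 / 3) *\<^sub>R h + (1 / 3) *\<^sub>R A + (1 / 3) *\<^sub>R B" by (simp add: P h P_add P_scale)
  then show "C \<in> convex hull {h, A, B}"
    unfolding convex_hull_3 by (intro CollectI exI[of _ "1 / 3"]) simp
  show "h \<notin> convex hull {A, B, C}"
  proof
    assume "h \<in> convex hull {A, B, C}"
    then obtain x' y' z' where "0 \<le> x'" "x' + y' + z' = 1" "h = P x' y' z'" using hull[of h] by auto
    then show False using P_inj[of "- 1" "- 1" 3 x' y' z'] by (simp add: h)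
  qed
qed

text \<open>The interior of each triangle is connected, meets the other triangle and avoids its
  frontier, so it is contained in it. Hence the hulls coincide, and the vertices are recovered as
  extreme points.\<close>

lemma overlapping_triangles_eq:
  fixes S T :: "(real ^ 2) set"
  assumes S: "card S = 3" "\<not> affine_dependent S" and T: "card T = 3" "\<not> affine_dependent T"
    and ST: "interior (convex hull S) \<inter> frontier (convex hull T) = {}"
    and TS: "interior (convex hull T) \<inter> frontier (convex hull S) = {}"
    and int: "interior (convex hull S) \<inter> interior (convex hull T) \<noteq> {}"
  shows "S = T"
proof -
  have sub: "convex hull X \<subseteq> convex hull Y"
    if X: "finite X" "interior (convex hull X) \<inter> frontier (convex hull Y) = {}"
      "interior (convex hull X) \<inter> interior (convex hull Y) \<noteq> {}" "finite Y" for X Y :: "(real ^ 2) set"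
  proof -
    have "interior (convex hull X) \<inter> convex hull Y \<noteq> {}"
      using X(3) interior_subset[of "convex hull Y"] by blast
    then have "interior (convex hull X) \<subseteq> convex hull Y"
      using connected_Int_frontier[of "interior (convex hull X)" "convex hull Y"] X(2)
      by (metis Diff_eq_empty_iff convex_connected convex_convex_hull convex_interior)
    then have "closure (interior (convex hull X)) \<subseteq> convex hull Y"
      using X by (intro closure_minimal compact_imp_closed finite_imp_compact_convex_hull)
    moreover have "closure (interior (convex hull X)) = closure (convex hull X)"
      using X(3) by (intro convex_closure_interior) auto
    moreover have "closure (convex hull X) = convex hull X"
      using X by (intro closure_closed compact_imp_closed finite_imp_compact_convex_hull)
    ultimately show ?thesis by simp
  qed
  have fin: "finite S" "finite T" using S T by (auto intro: card_ge_0_finite)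
  have "convex hull S = convex hull T"
    using sub[of S T] sub[of T S] ST TS int fin by blast
  then have "x \<in> S \<longleftrightarrow> x \<in> T" for x
    using extreme_point_of_convex_hull_affine_independent[OF S(2), of x]
      extreme_point_of_convex_hull_affine_independent[OF T(2), of x] by simp
  then show ?thesis by blast
qed

section \<open>Extending a drawing by one vertex\<close>

text \<open>Edges are treated as sets here, so that no endpoints have to be named and images of
  edges under a modified map can be rewritten directly.\<close>

lemma embedding_iff_hulls:
  assumes "\<And>e. e \<in> E \<Longrightarrow> card e = 2"
  shows "plane_straight_line_embedding V E \<phi> \<longleftrightarrow> inj_on \<phi> V \<and>
    (\<forall>e\<in>E. \<forall>f\<in>E. e \<noteq> f \<longrightarrow> convex hull (\<phi> ` e) \<inter> convex hull (\<phi> ` f) \<subseteq> \<phi> ` (e \<inter> f)) \<and>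
    (\<forall>e\<in>E. \<forall>w\<in>V - e. \<phi> w \<notin> convex hull (\<phi> ` e))"
proof -
  have seg: "convex hull (\<phi> ` {u, v}) = closed_segment (\<phi> u) (\<phi> v)" for u v
    by (simp add: segment_convex_hull)
  have edges: "(\<forall>e\<in>E. Q e) \<longleftrightarrow> (\<forall>u v. {u, v} \<in> E \<longrightarrow> Q {u, v})" for Q
    using assms by (metis card_2_iff)
  show ?thesis
    unfolding plane_straight_line_embedding_def edges seg by blast
qed

lemma embedding_triangle_not_collinear:
  assumes emb: "plane_straight_line_embedding V E \<phi>" and V: "a \<in> V" "b \<in> V" "c \<in> V"
    and ne: "a \<noteq> b" "b \<noteq> c" "a \<noteq> c" and E: "{a, b} \<in> E" "{b, c} \<in> E" "{a, c} \<in> E"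
  shows "\<not> collinear {\<phi> a, \<phi> b, \<phi> c}"
  using embedding_vertex_off_edge[OF emb] V ne E by (intro not_collinear_if_not_between) auto

text \<open>Emptiness is stated for edges only: it extends to vertices because none is isolated, and
  that distinct empty faces do not overlap is derived in
  \<open>face_interiors_disjoint\<close>.\<close>

definition empty_face :: "'v set set \<Rightarrow> ('v \<Rightarrow> real ^ 2) \<Rightarrow> 'v set \<Rightarrow> bool" where
  "empty_face E \<phi> X \<longleftrightarrow> (\<forall>e\<in>E. interior (convex hull (\<phi> ` X)) \<inter> convex hull (\<phi> ` e) = {})"

text \<open>
  A new vertex is placed at \<open>g\<close>, and \<open>D\<close> is a region that contains the drawing so far. Taking for
  \<open>D\<close> the complement of a bounded face covers insertions into that face, taking for \<open>D\<close> the
  outer triangle covers insertions into the outer face.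
\<close>

locale vertex_insertion =
  fixes V :: "'v set" and E :: "'v set set" and \<phi> :: "'v \<Rightarrow> real ^ 2"
    and v :: 'v and T :: "'v set" and g :: "real ^ 2" and D :: "(real ^ 2) set"
  assumes emb: "plane_straight_line_embedding V E \<phi>"
    and edge: "\<And>e. e \<in> E \<Longrightarrow> e \<subseteq> V" "\<And>e. e \<in> E \<Longrightarrow> card e = 2"
    and incident: "\<And>u. u \<in> V \<Longrightarrow> \<exists>e\<in>E. u \<in> e"
    and TV: "T \<subseteq> V" and v: "v \<notin> V"
    and D: "\<And>e. e \<in> E \<Longrightarrow> convex hull (\<phi> ` e) \<subseteq> D" "g \<notin> D"
    and spoke: "\<And>x. x \<in> T \<Longrightarrow> closed_segment g (\<phi> x) \<inter> D \<subseteq> {\<phi> x}"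
    and spokes: "\<And>x y. x \<in> T \<Longrightarrow> y \<in> T \<Longrightarrow> x \<noteq> y \<Longrightarrow> \<not> collinear {\<phi> x, g, \<phi> y}"
begin

abbreviation \<psi> :: "'v \<Rightarrow> real ^ 2" where
  "\<psi> \<equiv> \<phi>(v := g)"

lemma extended_image: "X \<subseteq> V \<Longrightarrow> \<psi> ` X = \<phi> ` X"
  using v by (intro image_cong) auto

lemma extended_image_insert: "X \<subseteq> V \<Longrightarrow> \<psi> ` insert v X = insert g (\<phi> ` X)"
  unfolding image_insert by (simp only: extended_image fun_upd_same)

lemma spoke_hull: "x \<in> V \<Longrightarrow> convex hull (\<psi> ` {v, x}) = closed_segment g (\<phi> x)"
  using extended_image_insert[of "{x}"] by (simp add: segment_convex_hull)

lemma vertex_in_D: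
  assumes "u \<in> V"
  shows "\<phi> u \<in> D"
proof -
  obtain e where e: "e \<in> E" "u \<in> e" using incident[OF assms] by blast
  then have "\<phi> u \<in> convex hull (\<phi> ` e)" by (simp add: hull_inc)
  with D(1)[OF e(1)] show ?thesis by blast
qed

text \<open>All old edges lie in \<open>D\<close>, which a spoke meets at most in its old endpoint,
  so a spoke and an old edge can meet only in a common vertex. Two spokes are not collinear and meet
  only in \<open>g\<close>.\<close>

lemma embedding_extended:
  "plane_straight_line_embedding (insert v V) (E \<union> stack_edges v T) \<psi>"
proof (subst embedding_iff_hulls)
  show "card e = 2" if "e \<in> E \<union> stack_edges v T" for e
    using that edge(2) TV v by (auto simp: stack_edges_def card_insert_if)
  have inj: "inj_on \<phi> V"
    and cross: "\<And>e f. e \<in> E \<Longrightarrow> f \<in> E \<Longrightarrow> e \<noteq> f \<Longrightarrow> convex hull (\<phi> ` e) \<inter> convex hull (\<phi> ` f) \<subseteq> \<phi> ` (e \<inter> f)"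
    and off: "\<And>e w. e \<in> E \<Longrightarrow> w \<in> V - e \<Longrightarrow> \<phi> w \<notin> convex hull (\<phi> ` e)"
    using iffD1[OF embedding_iff_hulls emb, OF edge(2)] by blast+
  have old: "convex hull (\<psi> ` e) = convex hull (\<phi> ` e)" if "e \<in> E" for e
    using extended_image[OF edge(1)[OF that]] by simp
  have mixed: "convex hull (\<psi> ` e) \<inter> convex hull (\<psi> ` {v, x}) \<subseteq> \<psi> ` (e \<inter> {v, x})"
    if e: "e \<in> E" and x: "x \<in> T" for e x
  proof
    fix p assume p: "p \<in> convex hull (\<psi> ` e) \<inter> convex hull (\<psi> ` {v, x})"
    have xV: "x \<in> V" using x TV by blast
    from p have pe: "p \<in> convex hull (\<phi> ` e)" and "p \<in> closed_segment g (\<phi> x)"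
      using old[OF e] spoke_hull[OF xV] by auto
    then have px: "p = \<phi> x" using D(1)[OF e] spoke[OF x] by blast
    then have "x \<in> e" using off[OF e, of x] pe xV by blast
    moreover have "\<psi> x = \<phi> x" using xV v by auto
    ultimately show "p \<in> \<psi> ` (e \<inter> {v, x})" unfolding px by (metis Int_iff image_eqI insertCI)
  qed
  have new: "convex hull (\<psi> ` {v, x}) \<inter> convex hull (\<psi> ` {v, y}) \<subseteq> \<psi> ` ({v, x} \<inter> {v, y})"
    if x: "x \<in> T" and y: "y \<in> T" and ne: "x \<noteq> y" for x y
  proof -
    have "closed_segment (\<phi> x) g \<inter> closed_segment g (\<phi> y) = {g}"
      using spokes[OF x y ne] by (intro Int_closed_segment) auto
    moreover have "g \<in> \<psi> ` ({v, x} \<inter> {v, y})" by auto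
    ultimately show ?thesis
      using spoke_hull[of x] spoke_hull[of y] x y TV by (auto simp: closed_segment_commute)
  qed
  have "inj_on \<psi> (insert v V)"
  proof -
    have "g \<notin> \<psi> ` V" using D(2) vertex_in_D extended_image[of V] by auto
    moreover have "inj_on \<psi> V" using inj v by (auto simp: inj_on_def)
    ultimately show ?thesis using v by simp
  qed
  moreover have "convex hull (\<psi> ` e) \<inter> convex hull (\<psi> ` f) \<subseteq> \<psi> ` (e \<inter> f)"
    if e: "e \<in> E \<union> stack_edges v T" and f: "f \<in> E \<union> stack_edges v T" and ne: "e \<noteq> f" for e f
  proof -
    consider "e \<in> E" "f \<in> E" | x where "e \<in> E" "f = {v, x}" "x \<in> T"
      | x where "e = {v, x}" "f \<in> E" "x \<in> T" | x y where "e = {v, x}" "f = {v, y}" "x \<in> T" "y \<in> T"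
      using e f by (auto simp: stack_edges_def)
    then show ?thesis
    proof cases
      case 1
      have "e \<inter> f \<subseteq> V" using edge(1)[OF 1(1)] by blast
      then show ?thesis using cross[OF 1 ne] old[OF 1(1)] old[OF 1(2)] extended_image[of "e \<inter> f"] by simp
    next
      case 2
      then show ?thesis using mixed by metis
    next
      case 3
      then show ?thesis using mixed[of f x] by (metis Int_commute)
    next
      case 4
      then show ?thesis using new[of x y] ne by metis
    qed
  qed
  moreover have "\<psi> w \<notin> convex hull (\<psi> ` e)" if e: "e \<in> E \<union> stack_edges v T" and w: "w \<in> insert v V - e" for e w
  proof -
    consider "e \<in> E" "w = v" | "e \<in> E" "w \<in> V" "w \<noteq> v" | x where "x \<in> T" "e = {v, x}" "w \<in> V" "w \<noteq> x" "w \<noteq> v"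
      using e w v by (auto simp: stack_edges_def)
    then show ?thesis
    proof cases
      case 1
      then show ?thesis using old[of e] D by auto
    next
      case 2
      then show ?thesis using old[of e] off[of e w] w by auto
    next
      case 3
      have x: "x \<in> V" using 3(1) TV by blast
      have "\<phi> w \<noteq> \<phi> x" using inj 3 x by (metis inj_onD)
      then have "\<phi> w \<notin> closed_segment g (\<phi> x)" using spoke[OF 3(1)] vertex_in_D[OF 3(3)] by blast
      then show ?thesis unfolding 3(2) spoke_hull[OF x] using 3(5) by simp
    qed
  qed
  ultimately show "inj_on \<psi> (insert v V) \<and>
    (\<forall>e\<in>E \<union> stack_edges v T. \<forall>f\<in>E \<union> stack_edges v T. e \<noteq> f \<longrightarrow>
        convex hull (\<psi> ` e) \<inter> convex hull (\<psi> ` f) \<subseteq> \<psi> ` (e \<inter> f)) \<and>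
    (\<forall>e\<in>E \<union> stack_edges v T. \<forall>w\<in>insert v V - e. \<psi> w \<notin> convex hull (\<psi> ` e))"
    by (intro conjI ballI impI)
qed

text \<open>Inside \<open>D\<close> a spoke has at most its old endpoint, and that vertex lies on an
  old edge, which avoids the interior of \<open>X\<close>.\<close>

lemma empty_face_extended_old:
  assumes X: "X \<subseteq> V" "empty_face E \<phi> X" "interior (convex hull (\<phi> ` X)) \<subseteq> D"
  shows "empty_face (E \<union> stack_edges v T) \<psi> X"
  unfolding empty_face_def
proof
  fix e assume e: "e \<in> E \<union> stack_edges v T"
  show "interior (convex hull (\<psi> ` X)) \<inter> convex hull (\<psi> ` e) = {}"
  proof (cases "e \<in> E")
    case True
    then show ?thesis
      using X(2) extended_image[OF X(1)] extended_image[OF edge(1)[OF True]]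
      unfolding empty_face_def by simp
  next
    case False
    with e obtain x where x: "x \<in> T" "e = {v, x}" by (auto simp: stack_edges_def)
    have xV: "x \<in> V" using x TV by blast
    obtain f where f: "f \<in> E" "x \<in> f" using incident[OF xV] by blast
    have "\<phi> x \<in> convex hull (\<phi> ` f)" using f by (simp add: hull_inc)
    then have "\<phi> x \<notin> interior (convex hull (\<phi> ` X))" using X(2) f(1) unfolding empty_face_def by blast
    then show ?thesis
      unfolding x(2) spoke_hull[OF xV] extended_image[OF X(1)] using spoke[OF x(1)] X(3) by blast
  qed
qed

text \<open>Old edges lie in \<open>D\<close> and two of the spokes are sides of the new triangle,
  so only the third spoke calls for a separate assumption.\<close>

lemma empty_face_extended_new:
  assumes T: "T = {x, y, z}"
    and "interior (convex hull {g, \<phi> x, \<phi> y}) \<inter> D = {}"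
    and "interior (convex hull {g, \<phi> x, \<phi> y}) \<inter> closed_segment g (\<phi> z) = {}"
  shows "empty_face (E \<union> stack_edges v T) \<psi> {v, x, y}"
  unfolding empty_face_def
proof
  have V: "x \<in> V" "y \<in> V" "z \<in> V" using TV T by auto
  fix e assume e: "e \<in> E \<union> stack_edges v T"
  have X: "\<psi> ` {v, x, y} = {g, \<phi> x, \<phi> y}" using V by (subst extended_image_insert) auto
  consider "e \<in> E" | "e = {v, x}" | "e = {v, y}" | "e = {v, z}"
    using e unfolding T stack_edges_triangle by blast
  then show "interior (convex hull (\<psi> ` {v, x, y})) \<inter> convex hull (\<psi> ` e) = {}"
  proof cases
    case 1
    then show ?thesis using assms(2) D(1)[OF 1] extended_image[OF edge(1)[OF 1]] unfolding X by auto
  next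
    case 2
    show ?thesis
      unfolding X unfolding 2 spoke_hull[OF V(1)] by (auto simp: interior_of_triangle)
  next
    case 3
    show ?thesis
      unfolding X unfolding 3 spoke_hull[OF V(2)] by (auto simp: interior_of_triangle closed_segment_commute)
  next
    case 4
    show ?thesis
      unfolding X unfolding 4 spoke_hull[OF V(3)] using assms(3) .
  qed
qed

end

section \<open>Drawings with a prescribed outer face\<close>

text \<open>Here \<open>X\<close> plays the outer face and \<open>F\<close> collects the bounded
  ones. Below, \<open>F\<close> is obtained by removing a single copy of \<open>X\<close>, so that
  the initial triangle can be both the outer and the inner face.\<close>

definition drawing :: "'v set \<Rightarrow> 'v set set \<Rightarrow> ('v \<Rightarrow> real ^ 2) \<Rightarrow> 'v set \<Rightarrow> 'v set multiset \<Rightarrow> bool" where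
  "drawing V E \<phi> X F \<longleftrightarrow> plane_straight_line_embedding V E \<phi> \<and>
     \<phi> ` V \<subseteq> convex hull (\<phi> ` X) \<and> (\<forall>Y\<in>#F. empty_face E \<phi> Y)"

lemma drawing_edge_in_outer:
  assumes "drawing V E \<phi> X F" "e \<subseteq> V"
  shows "convex hull (\<phi> ` e) \<subseteq> convex hull (\<phi> ` X)"
  using assms unfolding drawing_def by (intro hull_minimal) auto

text \<open>The sides of a face are edges, so the interior of an empty face avoids the frontier of
  any other face. Overlapping interiors would thus force equal vertex sets.\<close>

lemma face_interiors_disjoint:
  assumes st: "stacked_with_faces V E F" and emb: "plane_straight_line_embedding V E \<phi>"
    and X: "X \<in># F" "empty_face E \<phi> X" and Y: "Y \<in># F" "empty_face E \<phi> Y" and ne: "X \<noteq> Y"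
  shows "interior (convex hull (\<phi> ` X)) \<inter> interior (convex hull (\<phi> ` Y)) = {}"
proof (rule ccontr)
  assume meet: "interior (convex hull (\<phi> ` X)) \<inter> interior (convex hull (\<phi> ` Y)) \<noteq> {}"
  have inj: "inj_on \<phi> V" using emb unfolding plane_straight_line_embedding_def by blast
  have tri: "card (\<phi> ` Z) = 3 \<and> \<not> affine_dependent (\<phi> ` Z) \<and>
      (\<forall>W. empty_face E \<phi> W \<longrightarrow> interior (convex hull (\<phi> ` W)) \<inter> frontier (convex hull (\<phi> ` Z)) = {})"
    if Z: "Z \<in># F" for Z
  proof -
    note face = stacked_with_faces_face[OF st Z]
    obtain a b c where abc: "Z = {a, b, c}" "a \<noteq> b" "b \<noteq> c" "a \<noteq> c"
      using face(2) by (auto simp: card_3_iff)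
    have V: "a \<in> V" "b \<in> V" "c \<in> V" and E: "{a, b} \<in> E" "{b, c} \<in> E" "{a, c} \<in> E"
      using face abc by auto
    have nc: "\<not> collinear {\<phi> a, \<phi> b, \<phi> c}"
      using embedding_triangle_not_collinear[OF emb V abc(2-4) E] .
    have "card (\<phi> ` Z) = 3" using card_image[OF inj_on_subset[OF inj face(1)]] face(2) by simp
    moreover have "\<not> affine_dependent (\<phi> ` Z)"
      using nc unfolding abc(1) image_insert image_empty collinear_3_eq_affine_dependent by blast
    moreover have "interior (convex hull (\<phi> ` W)) \<inter> frontier (convex hull (\<phi> ` Z)) = {}"
      if "empty_face E \<phi> W" for W
    proof -
      have "interior (convex hull (\<phi> ` W)) \<inter> closed_segment (\<phi> u) (\<phi> w) = {}" if "{u, w} \<in> E" for u w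
        using bspec[OF \<open>empty_face E \<phi> W\<close>[unfolded empty_face_def] that]
        by (simp add: segment_convex_hull)
      from this[OF E(1)] this[OF E(2)] this[OF E(3)] show ?thesis
        unfolding abc(1) image_insert image_empty
        by (simp add: frontier_of_triangle closed_segment_commute Int_Un_distrib)
    qed
    ultimately show ?thesis by blast
  qed
  note triX = tri[OF X(1)] and triY = tri[OF Y(1)]
  have "interior (convex hull (\<phi> ` X)) \<inter> frontier (convex hull (\<phi> ` Y)) = {}"
    "interior (convex hull (\<phi> ` Y)) \<inter> frontier (convex hull (\<phi> ` X)) = {}"
    using triX triY X(2) Y(2) by blast+
  from overlapping_triangles_eq[OF _ _ _ _ this meet] have "\<phi> ` X = \<phi> ` Y"
    using triX triY by blast
  then have "X = Y"
    using inj stacked_with_faces_face(1)[OF st] X(1) Y(1) by (metis inj_on_image_eq_iff)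
  with ne show False by blast
qed

text \<open>The new vertex is placed at the centroid of the bounded face \<open>T\<close>, and the
  outer face remains \<open>X\<close>.\<close>

lemma stack_inside:
  assumes st: "stacked_with_faces V E F" and dr: "drawing V E \<phi> X (F - {#X#})" and X: "X \<in># F"
    and T: "T \<in># F - {#X#}" and v: "v \<notin> V"
  shows "\<exists>\<psi>. drawing (insert v V) (E \<union> stack_edges v T) \<psi> X (F - {#X#} - {#T#} + stack_faces v T)"
proof -
  have TF: "T \<in># F" using T by (rule in_diffD)
  note face = stacked_with_faces_face[OF st TF]
  have emb: "plane_straight_line_embedding V E \<phi>" and out: "\<phi> ` V \<subseteq> convex hull (\<phi> ` X)"
    and empty: "\<And>Y. Y \<in># F - {#X#} \<Longrightarrow> empty_face E \<phi> Y"
    using dr unfolding drawing_def by blast+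
  obtain a b c where abc: "T = {a, b, c}" "a \<noteq> b" "b \<noteq> c" "a \<noteq> c"
    using face(2) by (auto simp: card_3_iff)
  have V: "a \<in> V" "b \<in> V" "c \<in> V" and E: "{a, b} \<in> E" "{b, c} \<in> E" "{a, c} \<in> E"
    using face abc by auto
  define A B C where "A = \<phi> a" "B = \<phi> b" "C = \<phi> c"
  have nc: "\<not> collinear {A, B, C}"
    unfolding A_B_C_def using embedding_triangle_not_collinear[OF emb V abc(2-4) E] .
  then have nc': "\<not> collinear {B, C, A}" "\<not> collinear {A, C, B}" by (simp_all add: insert_commute)
  define g where "g = (1 / 3) *\<^sub>R (A + B + C)"
  have g': "(1 / 3) *\<^sub>R (B + C + A) = g" "(1 / 3) *\<^sub>R (A + C + B) = g" by (simp_all add: g_def add_ac)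
  note sep = centroid_separates[OF nc, folded g_def] centroid_separates[OF nc'(1), unfolded g']
    centroid_separates[OF nc'(2), unfolded g']
  have img: "\<phi> ` T = {A, B, C}" by (simp add: abc(1) A_B_C_def)
  define D where "D = - interior (convex hull (\<phi> ` T))"
  have gD: "g \<notin> D" using sep(3) by (simp add: D_def img)
  have spoke: "closed_segment g x \<inter> D \<subseteq> {x}" if "x \<in> {A, B, C}" for x
  proof -
    have "open_segment g x \<subseteq> interior (convex hull (\<phi> ` T))"
      using sep(3) that hull_inc[OF that, of convex] closure_subset unfolding img
      by (intro in_interior_closure_convex_segment) auto
    then show ?thesis using gD by (auto simp: D_def closed_segment_eq_open)
  qed
  interpret vertex_insertion V E \<phi> v T g D
  proof
    show "convex hull (\<phi> ` e) \<subseteq> D" if "e \<in> E" for e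
      using empty[OF T] that unfolding empty_face_def D_def by blast
    show "closed_segment g (\<phi> x) \<inter> D \<subseteq> {\<phi> x}" if "x \<in> T" for x
      using spoke[of "\<phi> x"] that img by blast
    have "\<not> collinear {g, x, y}" if "x \<in> {A, B, C}" "y \<in> {A, B, C}" "x \<noteq> y" for x y
      using that sep(1,4,7) by (auto simp: insert_commute)
    moreover have "inj_on \<phi> V" using emb unfolding plane_straight_line_embedding_def by blast
    ultimately show "\<not> collinear {\<phi> x, g, \<phi> y}" if "x \<in> T" "y \<in> T" "x \<noteq> y" for x y
      using that face(1) img by (metis image_eqI inj_onD insert_commute subsetD)
  qed (use emb stacked_with_faces_edge[OF st] stacked_with_faces_incident[OF st] face v gD in auto)
  have sub: "interior (convex hull {g, x, y}) \<inter> D = {}" if "x \<in> {A, B, C}" "y \<in> {A, B, C}" for x y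
  proof -
    have "g \<in> convex hull (\<phi> ` T)" using sep(3) interior_subset unfolding img by blast
    then have "convex hull {g, x, y} \<subseteq> convex hull (\<phi> ` T)"
      using that unfolding img by (intro hull_minimal) (auto simp: hull_inc)
    then show ?thesis unfolding D_def using interior_mono by blast
  qed
  have "empty_face (E \<union> stack_edges v T) \<psi> Y" if Y: "Y \<in># F - {#X#} - {#T#} + stack_faces v T" for Y
  proof (cases "Y \<in># F - {#X#} - {#T#}")
    case True
    then have Y': "Y \<in># F - {#X#}" by (rule in_diffD)
    \<comment> \<open>Only one copy of \<open>T\<close> is left besides the outer face, so every
      remaining face differs from \<open>T\<close> and has its interior disjoint from that of
      \<open>T\<close>.\<close>
    have "count (F - {#X#}) T \<le> 1" using stacked_with_faces_count[OF st] X by blast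
    then have "T \<notin># F - {#X#} - {#T#}" by (simp add: not_in_iff)
    then have "Y \<noteq> T" using True by blast
    then have "interior (convex hull (\<phi> ` Y)) \<subseteq> D"
      using face_interiors_disjoint[OF st emb in_diffD[OF Y'] empty[OF Y'] TF empty[OF T]]
      unfolding D_def by blast
    then show ?thesis
      using empty_face_extended_old stacked_with_faces_face(1)[OF st in_diffD[OF Y']] empty[OF Y'] by blast
  next
    case False
    with Y have "Y = {v, a, b} \<or> Y = {v, b, c} \<or> Y = {v, a, c}"
      by (simp add: abc stack_faces_triangle)
    moreover have "empty_face (E \<union> stack_edges v T) \<psi> {v, a, b}"
      using sub sep(2) abc(1) by (intro empty_face_extended_new[of a b c]) (auto simp: A_B_C_def)
    moreover have "empty_face (E \<union> stack_edges v T) \<psi> {v, b, c}"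
      using sub sep(5) abc(1) by (intro empty_face_extended_new[of b c a]) (auto simp: A_B_C_def)
    moreover have "empty_face (E \<union> stack_edges v T) \<psi> {v, a, c}"
      using sub sep(8) abc(1) by (intro empty_face_extended_new[of a c b]) (auto simp: A_B_C_def)
    ultimately show ?thesis by blast
  qed
  moreover have "\<psi> ` insert v V \<subseteq> convex hull (\<psi> ` X)"
  proof -
    have "convex hull (\<phi> ` T) \<subseteq> convex hull (\<phi> ` X)" using drawing_edge_in_outer[OF dr face(1)] .
    then have "g \<in> convex hull (\<phi> ` X)" using sep(3) interior_subset unfolding img by blast
    then show ?thesis
      unfolding extended_image[OF stacked_with_faces_face(1)[OF st X]] extended_image_insert[OF order_refl]
      using out by blast
  qed
  ultimately show ?thesis unfolding drawing_def using embedding_extended by blast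
qed

text \<open>The new vertex is placed beyond \<open>c\<close>, which makes \<open>{v, a, b}\<close>
  the outer face. Any other new face becomes the outer one after renaming \<open>a\<close>,
  \<open>b\<close>, \<open>c\<close>.\<close>

lemma stack_outside:
  assumes st: "stacked_with_faces V E F" and dr: "drawing V E \<phi> T (F - {#T#})" and TF: "T \<in># F"
    and T: "T = {a, b, c}" and v: "v \<notin> V"
  shows "\<exists>\<psi>. drawing (insert v V) (E \<union> stack_edges v T) \<psi> {v, a, b} (F - {#T#} + {#{v, b, c}, {v, a, c}#})"
proof -
  note face = stacked_with_faces_face[OF st TF]
  have emb: "plane_straight_line_embedding V E \<phi>" and out: "\<phi> ` V \<subseteq> convex hull (\<phi> ` T)"
    and empty: "\<And>Y. Y \<in># F - {#T#} \<Longrightarrow> empty_face E \<phi> Y"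
    using dr unfolding drawing_def by blast+
  have abc: "a \<noteq> b" "b \<noteq> c" "a \<noteq> c" using face(2) T by (auto simp: card_insert_if split: if_splits)
  have V: "a \<in> V" "b \<in> V" "c \<in> V" and E: "{a, b} \<in> E" "{b, c} \<in> E" "{a, c} \<in> E"
    using face abc T by auto
  define A B C where "A = \<phi> a" "B = \<phi> b" "C = \<phi> c"
  have nc: "\<not> collinear {A, B, C}"
    unfolding A_B_C_def using embedding_triangle_not_collinear[OF emb V abc E] .
  then have nc': "\<not> collinear {B, A, C}" by (simp add: insert_commute)
  define h where "h = 3 *\<^sub>R C - A - B"
  have h': "3 *\<^sub>R C - B - A = h" by (simp add: h_def)
  have BAC: "{B, A, C} = {A, B, C}" by auto
  note sep = reflected_point_separates[OF nc, folded h_def]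
  \<comment> \<open>Exchanging \<open>A\<close> and \<open>B\<close> fixes \<open>h\<close>, which
    provides the facts for the face \<open>{v, a, c}\<close>.\<close>
  note sep' = reflected_point_separates[OF nc', unfolded h' BAC]
  have img: "\<phi> ` T = {A, B, C}" by (simp add: T A_B_C_def)
  define D where "D = convex hull (\<phi> ` T)"
  interpret vertex_insertion V E \<phi> v T h D
  proof
    show "convex hull (\<phi> ` e) \<subseteq> D" if "e \<in> E" for e
      unfolding D_def using drawing_edge_in_outer[OF dr] stacked_with_faces_edge(1)[OF st that] by blast
    show "h \<notin> D" using sep(8) by (simp add: D_def img)
    show "closed_segment h (\<phi> x) \<inter> D \<subseteq> {\<phi> x}" if "x \<in> T" for x
    proof -
      have "\<phi> x = A \<or> \<phi> x = B \<or> \<phi> x = C" using that img by blast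
      then show ?thesis using sep(5,6) sep'(5) by (auto simp: D_def img)
    qed
    have "\<not> collinear {h, x, y}" if "x \<in> {A, B, C}" "y \<in> {A, B, C}" "x \<noteq> y" for x y
      using that sep(1,2) sep'(2) by (auto simp: insert_commute)
    moreover have "inj_on \<phi> V" using emb unfolding plane_straight_line_embedding_def by blast
    ultimately show "\<not> collinear {\<phi> x, h, \<phi> y}" if "x \<in> T" "y \<in> T" "x \<noteq> y" for x y
      using that face(1) img by (metis image_eqI inj_onD insert_commute subsetD)
  qed (use emb stacked_with_faces_edge[OF st] stacked_with_faces_incident[OF st] face v in auto)
  have "empty_face (E \<union> stack_edges v T) \<psi> Y" if Y: "Y \<in># F - {#T#} + {#{v, b, c}, {v, a, c}#}" for Y
  proof (cases "Y \<in># F - {#T#}")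
    case True
    have YV: "Y \<subseteq> V" using stacked_with_faces_face(1)[OF st in_diffD[OF True]] .
    have "interior (convex hull (\<phi> ` Y)) \<subseteq> D"
      unfolding D_def using drawing_edge_in_outer[OF dr YV] interior_subset by blast
    then show ?thesis using empty_face_extended_old YV empty[OF True] by blast
  next
    case False
    with Y have "Y = {v, b, c} \<or> Y = {v, a, c}" by simp
    moreover have "empty_face (E \<union> stack_edges v T) \<psi> {v, b, c}"
      using sep(3,4) T by (intro empty_face_extended_new[of b c a]) (auto simp: A_B_C_def D_def)
    moreover have "empty_face (E \<union> stack_edges v T) \<psi> {v, a, c}"
      using sep'(3,4) T by (intro empty_face_extended_new[of a c b]) (auto simp: A_B_C_def D_def)
    ultimately show ?thesis by blast
  qed
  moreover have "\<psi> ` insert v V \<subseteq> convex hull (\<psi> ` {v, a, b})"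
  proof -
    have X: "\<psi> ` {v, a, b} = {h, A, B}"
      using V extended_image_insert[of "{a, b}"] by (simp add: A_B_C_def)
    have "convex hull (\<phi> ` T) \<subseteq> convex hull {h, A, B}"
      unfolding img using sep(7) by (intro hull_minimal) (auto simp: hull_inc)
    moreover have "h \<in> convex hull {h, A, B}" by (simp add: hull_inc)
    ultimately show ?thesis
      unfolding X extended_image_insert[OF order_refl] using out by blast
  qed
  ultimately show ?thesis unfolding drawing_def using embedding_extended by blast
qed

lemma triangle_drawing:
  assumes "card {a, b, c} = 3"
  shows "\<exists>\<phi>. drawing {a, b, c} {{a, b}, {b, c}, {a, c}} \<phi> {a, b, c} {#{a, b, c}#}"
proof -
  have ne: "a \<noteq> b" "b \<noteq> c" "a \<noteq> c" using assms by (auto simp: card_insert_if split: if_splits)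
  define A B C :: "real ^ 2" where "A = 0" "B = axis 1 1" "C = axis 2 1"
  have nc: "\<not> collinear {A, B, C}"
    unfolding A_B_C_def collinear_lemma by (auto simp: axis_eq_0_iff vec_eq_iff axis_def forall_2)
  then have dist: "A \<noteq> B" "B \<noteq> C" "A \<noteq> C" by (auto simp: insert_commute)
  have nc': "\<not> collinear {B, C, A}" "\<not> collinear {C, A, B}" "\<not> collinear {A, C, B}"
    "\<not> collinear {B, A, C}" "\<not> collinear {C, B, A}"
    using nc by (simp_all add: insert_commute)
  define \<phi> where "\<phi> = (\<lambda>x. if x = a then A else if x = b then B else C)"
  have \<phi>: "\<phi> a = A" "\<phi> b = B" "\<phi> c = C" using ne by (auto simp: \<phi>_def)
  have seg: "convex hull {p, q} = closed_segment p q" for p q :: "real ^ 2"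
    by (simp add: segment_convex_hull)
  have ints: "closed_segment A B \<inter> closed_segment B C = {B}" "closed_segment B C \<inter> closed_segment C A = {C}"
    "closed_segment C A \<inter> closed_segment A B = {A}"
    using nc nc' by (intro Int_closed_segment; blast)+
  have notin: "C \<notin> closed_segment A B" "A \<notin> closed_segment B C" "B \<notin> closed_segment C A"
    using ints dist by (metis Int_iff ends_in_segment singletonD)+
  have inter: "{a, b} \<inter> {b, c} = {b}" "{b, c} \<inter> {a, c} = {c}" "{a, b} \<inter> {a, c} = {a}"
    using ne by auto
  have CA: "closed_segment A C = closed_segment C A" by (rule closed_segment_commute)
  have "plane_straight_line_embedding {a, b, c} {{a, b}, {b, c}, {a, c}} \<phi>"
  proof (subst embedding_iff_hulls)
    show "card e = 2" if "e \<in> {{a, b}, {b, c}, {a, c}}" for e using that ne by auto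
    have "inj_on \<phi> {a, b, c}" using \<phi> dist by (auto simp: inj_on_def)
    moreover have "\<forall>e\<in>{{a, b}, {b, c}, {a, c}}. \<forall>f\<in>{{a, b}, {b, c}, {a, c}}. e \<noteq> f \<longrightarrow>
        convex hull (\<phi> ` e) \<inter> convex hull (\<phi> ` f) \<subseteq> \<phi> ` (e \<inter> f)"
      using ints inter Int_commute[of "{b, c}" "{a, b}"] Int_commute[of "{a, c}" "{b, c}"] Int_commute[of "{a, c}" "{a, b}"]
      by (simp add: \<phi> seg CA) blast
    moreover have "\<forall>e\<in>{{a, b}, {b, c}, {a, c}}. \<forall>w\<in>{a, b, c} - e. \<phi> w \<notin> convex hull (\<phi> ` e)"
      using notin ne by (auto simp: \<phi> seg CA)
    ultimately show "inj_on \<phi> {a, b, c} \<and>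
      (\<forall>e\<in>{{a, b}, {b, c}, {a, c}}. \<forall>f\<in>{{a, b}, {b, c}, {a, c}}. e \<noteq> f \<longrightarrow>
        convex hull (\<phi> ` e) \<inter> convex hull (\<phi> ` f) \<subseteq> \<phi> ` (e \<inter> f)) \<and>
      (\<forall>e\<in>{{a, b}, {b, c}, {a, c}}. \<forall>w\<in>{a, b, c} - e. \<phi> w \<notin> convex hull (\<phi> ` e))"
      by blast
  qed
  moreover have "empty_face {{a, b}, {b, c}, {a, c}} \<phi> {a, b, c}"
    unfolding empty_face_def by (auto simp: \<phi> seg interior_of_triangle closed_segment_commute)
  moreover have "\<phi> ` {a, b, c} \<subseteq> convex hull (\<phi> ` {a, b, c})" by (rule hull_subset)
  ultimately show ?thesis unfolding drawing_def by auto
qed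

text \<open>If the desired outer face is an old one, the previous graph is drawn with it outside and
  the vertex goes into a bounded face. If it is a new one, the previous graph is drawn with the
  subdivided face outside and the vertex goes beyond it.\<close>

lemma stacked_with_faces_drawing:
  "stacked_with_faces V E F \<Longrightarrow> \<forall>X\<in>#F. \<exists>\<phi>. drawing V E \<phi> X (F - {#X#})"
proof (induction rule: stacked_with_faces.induct)
  case (triangle a b c)
  then show ?case using triangle_drawing by simp
next
  case (stack V E F a b c v)
  let ?T = "{a, b, c}" let ?N = "{#{v, a, b}, {v, b, c}, {v, a, c}#}"
  have T: "card ?T = 3" using stacked_with_faces_face(2)[OF stack.hyps(1,2)] .
  then have ne: "a \<noteq> b" "b \<noteq> c" "a \<noteq> c" by (auto simp: card_insert_if split: if_splits)
  have E': "E \<union> {{v, a}, {v, b}, {v, c}} = E \<union> stack_edges v ?T" by (simp add: stack_edges_triangle)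
  have N: "?N = stack_faces v ?T" using ne by (simp add: stack_faces_triangle)
  show ?case
  proof
    fix X assume X: "X \<in># F - {#?T#} + ?N"
    show "\<exists>\<phi>. drawing (insert v V) (E \<union> {{v, a}, {v, b}, {v, c}}) \<phi> X (F - {#?T#} + ?N - {#X#})"
    proof (cases "X \<in># F - {#?T#}")
      case True
      then have XF: "X \<in># F" by (rule in_diffD)
      obtain \<phi> where \<phi>: "drawing V E \<phi> X (F - {#X#})" using stack.IH XF by blast
      \<comment> \<open>\<open>X\<close> and \<open>?T\<close> may be the two copies of the initial
        triangle, so they are split off one after the other as multiset elements.\<close>
      define G where "G = F - {#?T#} - {#X#}"
      have FT: "F - {#?T#} = add_mset X G" unfolding G_def by (rule insert_DiffM[OF True, symmetric])
      have F: "F = add_mset ?T (add_mset X G)"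
        unfolding FT[symmetric] by (rule insert_DiffM[OF stack.hyps(2), symmetric])
      have FX: "F - {#X#} = add_mset ?T G"
        unfolding F add_mset_commute[of ?T X] by (rule add_mset_remove_trivial)
      then have "?T \<in># F - {#X#}" by simp
      from stack_inside[OF stack.hyps(1) \<phi> XF this stack.hyps(3)]
      obtain \<psi> where \<psi>: "drawing (insert v V) (E \<union> stack_edges v ?T) \<psi> X (F - {#X#} - {#?T#} + stack_faces v ?T)"
        by blast
      have "F - {#?T#} + ?N - {#X#} = F - {#X#} - {#?T#} + ?N"
        unfolding FT FX union_mset_add_mset_left add_mset_remove_trivial ..
      then show ?thesis using \<psi> unfolding E' N by metis
    next
      case False
      obtain \<phi> where \<phi>: "drawing V E \<phi> ?T (F - {#?T#})" using stack.IH stack.hyps(2) by blast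
      have out: "\<exists>\<psi>. drawing (insert v V) (E \<union> stack_edges v ?T) \<psi> {v, x, y} (F - {#?T#} + {#{v, y, z}, {v, x, z}#})"
        if "?T = {x, y, z}" for x y z
        using stack_outside[OF stack.hyps(1) \<phi> stack.hyps(2) that stack.hyps(3)] .
      have perm: "?T = {b, c, a}" "?T = {a, c, b}" "{v, c, a} = {v, a, c}" "{v, b, a} = {v, a, b}" "{v, c, b} = {v, b, c}"
        by auto
      have rm: "F - {#?T#} + ?N - {#{v, a, b}#} = F - {#?T#} + {#{v, b, c}, {v, a, c}#}"
        "F - {#?T#} + ?N - {#{v, b, c}#} = F - {#?T#} + {#{v, a, c}, {v, a, b}#}"
        "F - {#?T#} + ?N - {#{v, a, c}#} = F - {#?T#} + {#{v, b, c}, {v, a, b}#}"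
        by (simp_all add: add_mset_commute)
      from False X have "X = {v, a, b} \<or> X = {v, b, c} \<or> X = {v, a, c}" by simp
      then show ?thesis
      proof (elim disjE)
        assume "X = {v, a, b}"
        then show ?thesis using out[OF refl] unfolding E' by (simp only: rm)
      next
        assume "X = {v, b, c}"
        then show ?thesis using out[OF perm(1)] unfolding E' by (simp only: rm perm(3-5))
      next
        assume "X = {v, a, c}"
        then show ?thesis using out[OF perm(2)] unfolding E' by (simp only: rm perm(3-5))
      qed
    qed
  qed
qed

lemma stacked_with_faces_embedding:
  assumes "stacked_with_faces V E F"
  shows "\<exists>\<phi>. plane_straight_line_embedding V E \<phi>"
proof -
  have "F \<noteq> {#}" using assms by cases auto
  then obtain X where "X \<in># F" by blast
  then show ?thesis using stacked_with_faces_drawing[OF assms] unfolding drawing_def by blast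
qed

section \<open>Relabelling, and a finite universal set\<close>

lemma embedding_transport:
  assumes emb: "plane_straight_line_embedding (h ` V) ((`) h ` E) \<phi>"
    and h: "inj_on h V" and E: "\<And>e. e \<in> E \<Longrightarrow> e \<subseteq> V"
  shows "plane_straight_line_embedding V E (\<phi> \<circ> h)"
  unfolding plane_straight_line_embedding_def
proof (intro conjI allI impI)
  show "inj_on (\<phi> \<circ> h) V"
    using emb h unfolding plane_straight_line_embedding_def by (intro comp_inj_on) auto
next
  have edge: "{h u, h v} \<in> (`) h ` E" if "{u, v} \<in> E" for u v
    using that by (intro image_eqI[of _ _ "{u, v}"]) auto
  {
    fix u v x y assume *: "{u, v} \<in> E \<and> {x, y} \<in> E \<and> {u, v} \<noteq> {x, y}"
    then have sub: "{u, v} \<subseteq> V" "{x, y} \<subseteq> V" using E by blast+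
    have "h ` {u, v} \<noteq> h ` {x, y}" using * inj_on_image_eq_iff[OF h sub] by simp
    then have "closed_segment (\<phi> (h u)) (\<phi> (h v)) \<inter> closed_segment (\<phi> (h x)) (\<phi> (h y))
        \<subseteq> \<phi> ` ({h u, h v} \<inter> {h x, h y})"
      using emb edge * unfolding plane_straight_line_embedding_def by simp
    moreover have "{h u, h v} \<inter> {h x, h y} = h ` ({u, v} \<inter> {x, y})"
      using inj_on_image_Int[OF h sub] by simp
    ultimately show "closed_segment ((\<phi> \<circ> h) u) ((\<phi> \<circ> h) v) \<inter> closed_segment ((\<phi> \<circ> h) x) ((\<phi> \<circ> h) y)
        \<subseteq> (\<phi> \<circ> h) ` ({u, v} \<inter> {x, y})"
      by (simp add: image_comp)
  }
  fix u v w assume *: "{u, v} \<in> E \<and> w \<in> V - {u, v}"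
  then have "{u, v} \<subseteq> V" using E by blast
  then have "h w \<notin> {h u, h v}" using * h by (auto dest: inj_onD)
  moreover have "h w \<in> h ` V" using * by blast
  ultimately show "(\<phi> \<circ> h) w \<notin> closed_segment ((\<phi> \<circ> h) u) ((\<phi> \<circ> h) v)"
    using emb edge * unfolding plane_straight_line_embedding_def by simp
qed

text \<open>There are finitely many edge sets on \<open>{..<n}\<close>, and the points of one
  drawing for each drawable one suffice. A graph on any other vertex set is carried to
  \<open>{..<n}\<close> by a bijection.\<close>

lemma ex_universal: "\<exists>S. universal_for S (stacked_triangulations n)"
proof -
  define \<G> where "\<G> = {E \<in> Pow (Pow {..<n}). \<exists>\<phi>. plane_straight_line_embedding {..<n} E \<phi>}"
  have "\<forall>E\<in>\<G>. \<exists>\<phi>. plane_straight_line_embedding {..<n} E \<phi>" unfolding \<G>_def by blast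
  from bchoice[OF this] obtain \<Phi> where \<Phi>: "\<And>E. E \<in> \<G> \<Longrightarrow> plane_straight_line_embedding {..<n} E (\<Phi> E)"
    by blast
  define S where "S = (\<Union>E\<in>\<G>. \<Phi> E ` {..<n})"
  have "finite \<G>" unfolding \<G>_def by simp
  then have "finite S" unfolding S_def by simp
  moreover have "\<exists>\<phi>. plane_straight_line_embedding V E \<phi> \<and> \<phi> ` V \<subseteq> S"
    if VE: "(V, E) \<in> stacked_triangulations n" for V E
  proof -
    obtain F where F: "stacked_with_faces V E F" "card V = n"
      using VE unfolding stacked_triangulations_def by blast
    note edge = stacked_with_faces_edge(1)[OF F(1)]
    obtain \<phi> where \<phi>: "plane_straight_line_embedding V E \<phi>"
      using stacked_with_faces_embedding[OF F(1)] by blast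
    obtain h where h: "bij_betw h V {..<n}"
      using ex_bij_betw_finite_nat[OF stacked_with_faces_finite[OF F(1)]] F(2)
      by (auto simp: atLeast0LessThan)
    define k where "k = the_inv_into V h"
    have hV: "h ` V = {..<n}" and inj: "inj_on h V" using h by (auto simp: bij_betw_def)
    have kh: "k (h x) = x" if "x \<in> V" for x using that inj by (simp add: k_def the_inv_into_f_f)
    define E' where "E' = (`) h ` E"
    have k: "k ` {..<n} = V" "inj_on k {..<n}"
      using bij_betw_the_inv_into[OF h] by (simp_all add: k_def bij_betw_def)
    have kE: "(`) k ` E' = E"
    proof -
      have "k ` h ` e = e" if "e \<in> E" for e using edge[OF that] kh by (force simp: image_iff)
      then show ?thesis unfolding E'_def by (force simp: image_iff)
    qed
    have E'n: "e \<subseteq> {..<n}" if "e \<in> E'" for e using that edge hV unfolding E'_def by blast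
    have "plane_straight_line_embedding {..<n} E' (\<phi> \<circ> k)"
      using embedding_transport[of k "{..<n}" E' \<phi>] \<phi> k kE E'n by simp
    then have "E' \<in> \<G>" unfolding \<G>_def using E'n by blast
    from \<Phi>[OF this] have "plane_straight_line_embedding V E (\<Phi> E' \<circ> h)"
      using inj edge hV by (intro embedding_transport) (auto simp: E'_def)
    moreover have "(\<Phi> E' \<circ> h) ` V \<subseteq> S" using \<open>E' \<in> \<G>\<close> hV unfolding S_def image_comp[symmetric] by blast
    ultimately show ?thesis by blast
  qed
  ultimately have "universal_for S (stacked_triangulations n)" unfolding universal_for_def by blast
  then show ?thesis by blast
qed

lemma f_s_attained: "\<exists>S. universal_for S (stacked_triangulations n) \<and> card S = f_s n"
  unfolding f_s_def by (rule LeastI_ex) (use ex_universal in blast)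

section \<open>Asymptotics\<close>

text \<open>The logarithm of \<open>x powr x * (x - 1) powr (1 - x)\<close>. It is also the
  exponential growth rate in \<open>n\<close> of the number of \<open>n\<close>-subsets of a set of
  about \<open>x * n\<close> points.\<close>

definition rate :: "real \<Rightarrow> real" where
  "rate x = x * ln x - (x - 1) * ln (x - 1)"

lemma powr_eq_2_iff_rate:
  assumes "x > 1"
  shows "x powr x * (x - 1) powr (1 - x) = 2 \<longleftrightarrow> rate x = ln 2"
proof -
  have "x powr x * (x - 1) powr (1 - x) = exp (rate x)"
    using assms by (simp add: powr_def rate_def exp_add[symmetric] algebra_simps)
  then show ?thesis
    by (metis exp_ln exp_inj_iff zero_less_numeral)
qed

lemma rate_strict_mono:
  assumes "1 < x" "x < y"
  shows "rate x < rate y"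
proof (rule DERIV_pos_imp_increasing[OF assms(2)])
  fix z assume z: "x \<le> z" "z \<le> y"
  have "(rate has_real_derivative (ln z - ln (z - 1))) (at z)"
    unfolding rate_def using z assms(1) by (auto intro!: derivative_eq_intros)
  moreover have "ln z - ln (z - 1) > 0" using z assms(1) by simp
  ultimately show "\<exists>d. DERIV rate z :> d \<and> d > 0" by blast
qed

lemma continuous_on_rate: "continuous_on {1.293..1.294} rate"
  unfolding rate_def by (auto intro!: continuous_intros)

lemma rate_bounds: "rate 1.293 \<le> ln 2" "ln 2 < rate 1.294"
proof -
  \<comment> \<open>Multiplication by 4 brings the arguments close to 1, where a short series gives
    a sufficient enclosure.\<close>
  have l: "ln (0.293::real) = ln 1.172 - 2 * ln 2" "ln (0.294::real) = ln 1.176 - 2 * ln 2"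
  proof -
    have "ln (4::real) = 2 * ln 2" using ln_realpow[of 2 2] by simp
    moreover have "ln (0.293::real) = ln 1.172 - ln 4" "ln (0.294::real) = ln 1.176 - ln 4"
      using ln_div[of "1.172::real" 4] ln_div[of "1.176::real" 4] by simp_all
    ultimately show "ln (0.293::real) = ln 1.172 - 2 * ln 2" "ln (0.294::real) = ln 1.176 - 2 * ln 2"
      by simp_all
  qed
  have two: "ln (2::real) \<in> {0.6930..0.6932}"
    using ln_approx_bounds[of "2" 4] by (simp add: eval_nat_numeral)
  have a: "ln (1.293::real) \<in> {0.2569..0.25698}"
    using ln_approx_bounds[of "1.293" 3] by (simp add: eval_nat_numeral)
  have b: "ln (1.172::real) \<in> {0.1586..0.1588}"
    using ln_approx_bounds[of "1.172" 2] by (simp add: eval_nat_numeral)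
  have c: "ln (1.294::real) \<in> {0.25773..0.2578}"
    using ln_approx_bounds[of "1.294" 3] by (simp add: eval_nat_numeral)
  have d: "ln (1.176::real) \<in> {0.162..0.16213}"
    using ln_approx_bounds[of "1.176" 2] by (simp add: eval_nat_numeral)
  \<comment> \<open>With the logarithms replaced by variables, the estimate becomes a linear
    inequality.\<close>
  have "1.293 * x - 0.293 * (y - 2 * z) \<le> z" if "x \<le> 0.25698" "0.1586 \<le> y" "0.693 \<le> z" for x y z :: real
    using that by (simp add: field_simps)
  from this[of "ln 1.293" "ln 1.172" "ln 2"] two a b
  have "1.293 * ln 1.293 - 0.293 * (ln 1.172 - 2 * ln 2) \<le> ln (2::real)" by simp
  then show "rate 1.293 \<le> ln 2" using l(1) unfolding rate_def by simp
  have "z < 1.294 * x - 0.294 * (y - 2 * z)" if "0.25773 \<le> x" "y \<le> 0.16213" "z \<le> 0.6932" for x y z :: real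
    using that by (simp add: field_simps)
  from this[of "ln 1.294" "ln 1.176" "ln 2"] two c d
  have "ln (2::real) < 1.294 * ln 1.294 - 0.294 * (ln 1.176 - 2 * ln 2)" by simp
  then show "ln 2 < rate 1.294" using l(2) unfolding rate_def by simp
qed

lemma ex_rate_eq_ln2: "\<exists>x. 1.293 \<le> x \<and> x < 1.294 \<and> rate x = ln 2"
proof -
  obtain x where x: "1.293 \<le> x" "x \<le> 1.294" "rate x = ln 2"
    using IVT'[of rate "1.293" "ln 2" "1.294"] rate_bounds continuous_on_rate by auto
  have "x \<noteq> 1.294" using rate_bounds(2) x(3) by (metis less_irrefl)
  with x show ?thesis by (intro exI[of _ x]) auto
qed

section \<open>From the counting bound to the asymptotic estimate\<close>

text \<open>The left-hand side is a single term of the binomial expansion.\<close>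

lemma binomial_mult_power_le:
  fixes x :: real
  assumes "0 \<le> x"
  shows "real (m choose n) * x ^ n \<le> (1 + x) ^ m"
proof (cases "n \<le> m")
  case True
  have "real (m choose n) * x ^ n \<le> (\<Sum>k\<le>m. real (m choose k) * x ^ k)"
    using True assms by (intro member_le_sum[of n]) auto
  also have "\<dots> = (1 + x) ^ m"
    using binomial_ring[of x 1 m] by (simp add: add.commute)
  finally show ?thesis .
qed (use assms in \<open>simp add: binomial_eq_0\<close>)

lemma rate_lower_bound:
  fixes \<alpha> :: real
  assumes \<alpha>: "\<alpha> > 1" "rate \<alpha> = ln 2" and "n > 0"
    and le: "2 ^ n \<le> 16 * real n ^ 3 * real (m choose n)"
  shows "(\<alpha> - ln (16 * real n ^ 3) / (real n * ln (\<alpha> / (\<alpha> - 1)))) * real n \<le> real m"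
proof -
  \<comment> \<open>This value minimises \<open>(1 + x) ^ m / x ^ n\<close> for
    \<open>m = \<alpha> * n\<close>, where the bound on the binomial coefficient has to be
    sharp.\<close>
  define x where "x = 1 / (\<alpha> - 1)"
  define L where "L = ln (\<alpha> / (\<alpha> - 1))"
  have x: "x > 0" using \<alpha> by (simp add: x_def)
  have x1: "1 + x = \<alpha> / (\<alpha> - 1)" using \<alpha> by (simp add: x_def field_simps)
  have L: "L > 0" using \<alpha> by (simp add: L_def)
  have L': "L = ln \<alpha> - ln (\<alpha> - 1)" using \<alpha> by (simp add: L_def ln_div)
  have "2 ^ n * x ^ n \<le> 16 * real n ^ 3 * (real (m choose n) * x ^ n)"
    using mult_right_mono[OF le, of "x ^ n"] x by (simp add: mult_ac)
  also have "\<dots> \<le> 16 * real n ^ 3 * (1 + x) ^ m"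
    using binomial_mult_power_le[of x m n] x by (intro mult_left_mono) auto
  finally have "ln (2 ^ n * x ^ n) \<le> ln (16 * real n ^ 3 * (1 + x) ^ m)"
    using x \<open>n > 0\<close> by (subst ln_le_cancel_iff) (auto intro!: mult_pos_pos)
  also have "ln (2 ^ n * x ^ n) = real n * (ln 2 + ln x)"
    using x by (simp add: ln_mult ln_realpow algebra_simps)
  also have "ln (16 * real n ^ 3 * (1 + x) ^ m) = ln (16 * real n ^ 3) + real m * L"
    using x \<open>n > 0\<close> by (subst ln_mult) (use \<alpha> in \<open>auto simp: ln_realpow x1 L_def\<close>)
  \<comment> \<open>The defining equation of \<open>\<alpha>\<close> enters here:
    \<open>rate \<alpha> - ln (\<alpha> - 1)\<close> is
    \<open>\<alpha> * (ln \<alpha> - ln (\<alpha> - 1))\<close>.\<close>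
  also have "ln 2 + ln x = \<alpha> * L"
    using \<alpha> by (simp add: x_def L' ln_div rate_def algebra_simps)
  finally have "real n * (\<alpha> * L) - ln (16 * real n ^ 3) \<le> real m * L" by simp
  then have "(real n * (\<alpha> * L) - ln (16 * real n ^ 3)) / L \<le> real m"
    using L by (simp add: divide_le_eq)
  moreover have "(real n * (\<alpha> * L) - ln (16 * real n ^ 3)) / L = (\<alpha> - ln (16 * real n ^ 3) / (real n * L)) * real n"
    using L \<open>n > 0\<close> by (simp add: field_simps)
  ultimately show ?thesis by (simp add: L_def)
qed

lemma error_term_smallo:
  fixes c :: real
  assumes "c > 0"
  shows "(\<lambda>n. ln (16 * real n ^ 3) / (real n * c)) \<in> o(\<lambda>_. 1)"
  using assms by real_asymp

theorem theorem1:
  "\<exists>\<alpha>::real.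
     \<alpha> > 1 \<and> \<alpha> powr \<alpha> * (\<alpha> - 1) powr (1 - \<alpha>) = 2 \<and>
     (\<forall>\<beta>::real. \<beta> > 1 \<and> \<beta> powr \<beta> * (\<beta> - 1) powr (1 - \<beta>) = 2 \<longrightarrow> \<beta> = \<alpha>) \<and>
     1.293 \<le> \<alpha> \<and> \<alpha> < 1.294 \<and>
     (\<exists>\<epsilon> :: nat \<Rightarrow> real. \<epsilon> \<in> o(\<lambda>_. 1) \<and>
        (\<forall>\<^sub>F n in sequentially. real (f_s n) \<ge> (\<alpha> - \<epsilon> n) * real n))"
proof -
  obtain \<alpha> where \<alpha>: "1.293 \<le> \<alpha>" "\<alpha> < 1.294" "rate \<alpha> = ln 2" using ex_rate_eq_ln2 by blast
  have gt: "\<alpha> > 1" using \<alpha>(1) by simp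
  have unique: "\<beta> = \<alpha>" if "\<beta> > 1" "\<beta> powr \<beta> * (\<beta> - 1) powr (1 - \<beta>) = 2" for \<beta>
  proof -
    have "rate \<beta> = rate \<alpha>" using that powr_eq_2_iff_rate \<alpha>(3) by simp
    then show ?thesis
      using rate_strict_mono[of \<alpha> \<beta>] rate_strict_mono[of \<beta> \<alpha>] gt that(1) by linarith
  qed
  \<comment> \<open>The polynomial factor \<open>16 * n ^ 3\<close> of the counting bound costs only
    a term of order \<open>ln n / n\<close>.\<close>
  define \<epsilon> where "\<epsilon> = (\<lambda>n. ln (16 * real n ^ 3) / (real n * ln (\<alpha> / (\<alpha> - 1))))"
  have "\<epsilon> \<in> o(\<lambda>_. 1)" unfolding \<epsilon>_def using gt by (intro error_term_smallo) simp
  moreover have "\<forall>\<^sub>F n in sequentially. real (f_s n) \<ge> (\<alpha> - \<epsilon> n) * real n"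
    using eventually_ge_at_top[of 4]
  proof eventually_elim
    case (elim n)
    obtain S where S: "universal_for S (stacked_triangulations n)" "card S = f_s n"
      using f_s_attained by blast
    from rate_lower_bound[OF gt \<alpha>(3) _ universal_card_bound_real[OF S(1) elim]] elim
    show ?case by (simp add: \<epsilon>_def S(2))
  qed
  moreover have "\<alpha> powr \<alpha> * (\<alpha> - 1) powr (1 - \<alpha>) = 2" using powr_eq_2_iff_rate[OF gt] \<alpha>(3) by simp
  ultimately show ?thesis using gt unique \<alpha>(1,2) by blast
qed

end
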